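(* Suppose $\Gamma$ is (isomorphic as a topological group to) the automorphism group of a countable ultrahomogeneous structure in a finite relational language. Then $\Gamma$ is graphic.
   Context: A structure $M$ is ultrahomogeneous if every isomorphism between finite substructures of $M$ extends to an automorphism of $M$; its automorphism group carries the pointwise convergence topology. A Polish group $\Gamma$ is graphic if for every Borel action of $\Gamma$ on a Polish space $X$, the orbit equivalence relation equals the connectedness relation of some Borel graph on $X$. *)

theory Defs
  imports "HOL-Analysis.Analysis" "HOL-Algebra.Group_Action"
begin

definition polish_space :: "'a topology \<Rightarrow> bool" where
  "polish_space X \<longleftrightarrow> completely_metrizable_space X \<and> separable_space X"

definition borel_of :: "'a topology \<Rightarrow> 'a measure" where
  "borel_of X = sigma (topspace X) {U. openin X U}"

definition topological_group :: "('g, 'm) monoid_scheme \<Rightarrow> 'g topology \<Rightarrow> bool" where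
  "topological_group \<Gamma> T \<longleftrightarrow>
     group \<Gamma> \<and> topspace T = carrier \<Gamma> \<and>
     continuous_map (prod_topology T T) T (\<lambda>(g, h). g \<otimes>\<^bsub>\<Gamma>\<^esub> h) \<and>
     continuous_map T T (\<lambda>g. inv\<^bsub>\<Gamma>\<^esub> g)"

definition polish_group :: "('g, 'm) monoid_scheme \<Rightarrow> 'g topology \<Rightarrow> bool" where
  "polish_group \<Gamma> T \<longleftrightarrow> topological_group \<Gamma> T \<and> polish_space T"

definition topological_group_isomorphic ::
  "('g, 'm) monoid_scheme \<Rightarrow> 'g topology \<Rightarrow> ('h, 'n) monoid_scheme \<Rightarrow> 'h topology \<Rightarrow> bool" where
  "topological_group_isomorphic \<Gamma> T \<Delta> S \<longleftrightarrow>
     (\<exists>\<psi>. \<psi> \<in> iso \<Gamma> \<Delta> \<and> homeomorphic_map T S \<psi>)"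

definition borel_action ::
  "('g, 'm) monoid_scheme \<Rightarrow> 'g topology \<Rightarrow> 'x topology \<Rightarrow> ('g \<Rightarrow> 'x \<Rightarrow> 'x) \<Rightarrow> bool" where
  "borel_action \<Gamma> T X \<phi> \<longleftrightarrow>
     group_action \<Gamma> (topspace X) \<phi> \<and>
     (\<lambda>(g, x). \<phi> g x) \<in> borel_of (prod_topology T X) \<rightarrow>\<^sub>M borel_of X"

definition orbit_equivalence_relation ::
  "('g, 'm) monoid_scheme \<Rightarrow> 'x topology \<Rightarrow> ('g \<Rightarrow> 'x \<Rightarrow> 'x) \<Rightarrow> ('x \<times> 'x) set" where
  "orbit_equivalence_relation \<Gamma> X \<phi> = {(x, y). x \<in> topspace X \<and> y \<in> orbit \<Gamma> \<phi> x}"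

definition borel_graph :: "'x topology \<Rightarrow> ('x \<times> 'x) set \<Rightarrow> bool" where
  "borel_graph X G \<longleftrightarrow> G \<in> sets (borel_of (prod_topology X X)) \<and> sym G \<and> irrefl G"

definition connectedness_relation :: "'x topology \<Rightarrow> ('x \<times> 'x) set \<Rightarrow> ('x \<times> 'x) set" where
  "connectedness_relation X G = {(x, y). x \<in> topspace X \<and> y \<in> topspace X \<and> (x, y) \<in> G\<^sup>*}"

text \<open>
  A definition cannot quantify over all types, so the type containing the points of the Polish
  space is a parameter. Being graphic means that this holds for every type \<open>'x\<close>.
\<close>

definition graphic :: "'x itself \<Rightarrow> ('g, 'm) monoid_scheme \<Rightarrow> 'g topology \<Rightarrow> bool" where
  "graphic tx \<Gamma> T \<longleftrightarrow>
     polish_group \<Gamma> T \<and>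
     (\<forall>(X :: 'x topology) \<phi>. polish_space X \<and> borel_action \<Gamma> T X \<phi> \<longrightarrow>
        (\<exists>G. borel_graph X G \<and>
             orbit_equivalence_relation \<Gamma> X \<phi> = connectedness_relation X G))"

record 'r rel_language =
  symbols :: "'r set"
  arity :: "'r \<Rightarrow> nat"

record ('r, 'a) rel_structure =
  universe :: "'a set"
  interp :: "'r \<Rightarrow> 'a list set"

definition is_structure :: "'r rel_language \<Rightarrow> ('r, 'a) rel_structure \<Rightarrow> bool" where
  "is_structure L M \<longleftrightarrow>
     (\<forall>r \<in> symbols L. interp M r \<subseteq> {xs \<in> lists (universe M). length xs = arity L r})"

text \<open>In a relational language every subset of the universe carries a substructure.\<close>

definition substructure :: "('r, 'a) rel_structure \<Rightarrow> 'a set \<Rightarrow> ('r, 'a) rel_structure" where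
  "substructure M A = \<lparr>universe = A, interp = (\<lambda>r. interp M r \<inter> lists A)\<rparr>"

definition structure_iso ::
  "'r rel_language \<Rightarrow> ('r, 'a) rel_structure \<Rightarrow> ('r, 'b) rel_structure \<Rightarrow> ('a \<Rightarrow> 'b) set" where
  "structure_iso L M N =
     {f. bij_betw f (universe M) (universe N) \<and>
         (\<forall>r \<in> symbols L. \<forall>xs \<in> lists (universe M). length xs = arity L r \<longrightarrow>
            (xs \<in> interp M r \<longleftrightarrow> map f xs \<in> interp N r))}"

text \<open>Automorphisms are extensional outside the universe, as in \<open>BijGroup\<close>.\<close>

definition automorphisms :: "'r rel_language \<Rightarrow> ('r, 'a) rel_structure \<Rightarrow> ('a \<Rightarrow> 'a) set" where
  "automorphisms L M = structure_iso L M M \<inter> Bij (universe M)"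

definition Aut_group :: "'r rel_language \<Rightarrow> ('r, 'a) rel_structure \<Rightarrow> ('a \<Rightarrow> 'a) monoid" where
  "Aut_group L M = BijGroup (universe M) \<lparr>carrier := automorphisms L M\<rparr>"

definition Aut_topology :: "'r rel_language \<Rightarrow> ('r, 'a) rel_structure \<Rightarrow> ('a \<Rightarrow> 'a) topology" where
  "Aut_topology L M =
     subtopology (product_topology (\<lambda>_. discrete_topology (universe M)) (universe M))
       (automorphisms L M)"

definition ultrahomogeneous :: "'r rel_language \<Rightarrow> ('r, 'a) rel_structure \<Rightarrow> bool" where
  "ultrahomogeneous L M \<longleftrightarrow>
     (\<forall>A B f. finite A \<and> A \<subseteq> universe M \<and> finite B \<and> B \<subseteq> universe M \<and>
        f \<in> structure_iso L (substructure M A) (substructure M B) \<longrightarrow>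
        (\<exists>g \<in> automorphisms L M. \<forall>a \<in> A. g a = f a))"

end

theory Submission
  imports Defs
begin

text \<open>
  Let \<open>A\<close> be the automorphism group acting on the Polish space \<open>X\<close>. A point \<open>x\<close> with an open
  stabilizer has a countable orbit, which is connected by the graphs of the elements of a countable
  dense subset of \<open>A\<close>. For any other point \<open>x\<close> and any \<open>h \<in> A\<close> there is a \<open>g \<in> A\<close> such that
  \<open>y = g x\<close> codes both \<open>g\<close> and \<open>g h\<inverse>\<close>, so that \<open>x\<close> and \<open>h x\<close> are both adjacent to \<open>y\<close> in the Borel
  graph that joins \<open>z\<close> to \<open>y\<close> if one of the two elements decoded from \<open>y\<close> moves \<open>z\<close> to \<open>y\<close>.

  The Vaught transforms of basic open sets turn \<open>y\<close> into a structure on the universe, and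
  equivariantly so. Coding and decoding maintain a finite set \<open>R\<close> of elements of the universe.
  The next bit of \<open>y\<close> is the truth value of the first atomic fact that is not constant on the orbit
  of \<open>y\<close> under the pointwise stabilizer of \<open>R\<close>; its parameters are then added to \<open>R\<close>. The choice of
  this fact depends on that orbit only, hence it is the same for the coder and the decoder,
  whichever of \<open>x\<close> and \<open>h x\<close> one starts from. For the approximations of \<open>g\<close> to converge to a surjective map,
  every element of the universe must eventually be moved into \<open>R\<close>. This works without additional
  information for the decoder, because the stabilizer of \<open>R\<close> has finitely many orbits, whose
  representatives can all be added to \<open>R\<close>: here ultrahomogeneity and finiteness of the language
  enter.
\<close>

section \<open>Countable bases and Borel sets\<close>

definition countable_base :: "'a topology \<Rightarrow> 'a set set \<Rightarrow> bool" where
  "countable_base X \<B> \<longleftrightarrow>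
     countable \<B> \<and> (\<forall>V\<in>\<B>. openin X V) \<and>
     (\<forall>U x. openin X U \<and> x \<in> U \<longrightarrow> (\<exists>V\<in>\<B>. x \<in> V \<and> V \<subseteq> U))"

lemma second_countable_iff_countable_base:
  "second_countable X \<longleftrightarrow> (\<exists>\<B>. countable_base X \<B>)"
  by (simp add: second_countable_def countable_base_def)

lemma countable_base_countable: "countable_base X \<B> \<Longrightarrow> countable \<B>"
  by (simp add: countable_base_def)

lemma countable_base_openin: "countable_base X \<B> \<Longrightarrow> V \<in> \<B> \<Longrightarrow> openin X V"
  by (simp add: countable_base_def)

lemma countable_base_elem:
  assumes "countable_base X \<B>" "openin X U" "x \<in> U"
  obtains V where "V \<in> \<B>" "x \<in> V" "V \<subseteq> U"
  using assms unfolding countable_base_def by meson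

lemma countable_base_insert_empty: "countable_base X \<B> \<Longrightarrow> countable_base X (insert {} \<B>)"
  unfolding countable_base_def by auto

lemma countable_base_Union:
  assumes "countable_base X \<B>" "openin X U"
  shows "U = \<Union>{V \<in> \<B>. V \<subseteq> U}"
  using countable_base_elem[OF assms] by blast

lemma countable_base_separates:
  assumes \<B>: "countable_base X \<B>" and X: "t1_space X"
    and x: "x \<in> topspace X" "y \<in> topspace X" and contained: "\<And>V. V \<in> \<B> \<Longrightarrow> x \<in> V \<Longrightarrow> y \<in> V"
  shows "x = y"
proof (rule ccontr)
  assume "x \<noteq> y"
  then obtain U where U: "openin X U" "x \<in> U" "y \<notin> U"
    using X x unfolding t1_space_def by blast
  obtain V where "V \<in> \<B>" "x \<in> V" "V \<subseteq> U" by (rule countable_base_elem[OF \<B> U(1,2)])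
  then show False using U(3) contained by blast
qed

lemma countable_base_prod:
  assumes X: "countable_base X \<B>" and Y: "countable_base Y \<C>"
  shows "countable_base (prod_topology X Y) ((\<lambda>(V, W). V \<times> W) ` (\<B> \<times> \<C>))"
  unfolding countable_base_def
proof (intro conjI ballI allI impI)
  show "countable ((\<lambda>(V, W). V \<times> W) ` (\<B> \<times> \<C>))"
    using X Y by (auto dest: countable_base_countable)
  show "openin (prod_topology X Y) Q" if "Q \<in> (\<lambda>(V, W). V \<times> W) ` (\<B> \<times> \<C>)" for Q
    using that X Y by (auto simp: openin_prod_Times_iff dest: countable_base_openin)
  fix Q p assume Q: "openin (prod_topology X Y) Q \<and> p \<in> Q"
  obtain x y where p: "p = (x, y)" by fastforce
  then obtain U U' where U: "openin X U" "openin Y U'" "x \<in> U" "y \<in> U'" "U \<times> U' \<subseteq> Q"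
    using Q unfolding openin_prod_topology_alt by meson
  obtain V where "V \<in> \<B>" "x \<in> V" "V \<subseteq> U" by (rule countable_base_elem[OF X U(1,3)])
  moreover obtain W where "W \<in> \<C>" "y \<in> W" "W \<subseteq> U'" by (rule countable_base_elem[OF Y U(2,4)])
  ultimately show "\<exists>R\<in>(\<lambda>(V, W). V \<times> W) ` (\<B> \<times> \<C>). p \<in> R \<and> R \<subseteq> Q"
    using p U(5) by (intro bexI[of _ "V \<times> W"]) auto
qed

lemma metrizable_separable_imp_second_countable:
  assumes "metrizable_space X" "separable_space X"
  shows "second_countable X"
proof -
  obtain M d where "Metric_space M d" and X: "X = Metric_space.mtopology M d"
    using assms(1) unfolding metrizable_space_def by blast
  interpret Metric_space M d by fact
  obtain D where D: "countable D" "D \<subseteq> M" "\<forall>U. openin mtopology U \<and> U \<noteq> {} \<longrightarrow> D \<inter> U \<noteq> {}"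
    using assms(2) unfolding separable_space_def X dense_intersects_open by auto
  define \<B> where "\<B> = (\<lambda>(c, n). mball c (inverse (real (Suc n)))) ` (D \<times> UNIV)"
  have "\<exists>V\<in>\<B>. x \<in> V \<and> V \<subseteq> U" if U: "openin mtopology U" "x \<in> U" for U x
  proof -
    obtain r where r: "r > 0" "mball x r \<subseteq> U" and x: "x \<in> M"
      using U openin_mtopology by blast
    obtain n where n: "inverse (real (Suc n)) < r / 2"
      using reals_Archimedean[of "r / 2"] r(1) by auto
    have "x \<in> mball x (inverse (real (Suc n)))" using x by simp
    then have "D \<inter> mball x (inverse (real (Suc n))) \<noteq> {}"
      using D(3) openin_mball by blast
    then obtain c where c: "c \<in> D" "c \<in> mball x (inverse (real (Suc n)))" by blast
    then have "d c x < r / 2" using n by (simp add: commute)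
    then have "mball c (inverse (real (Suc n))) \<subseteq> mball x r"
      using n c x by (intro mball_subset) auto
    then show ?thesis
      using c r(2) x
      by (intro bexI[of _ "mball c (inverse (real (Suc n)))"]) (auto simp: \<B>_def commute)
  qed
  then have "countable_base X \<B>"
    unfolding countable_base_def X using D(1) by (intro conjI) (auto simp: \<B>_def)
  then show ?thesis by (auto simp: second_countable_iff_countable_base)
qed

lemma polish_space_imp_second_countable: "polish_space X \<Longrightarrow> second_countable X"
  by (simp add: polish_space_def metrizable_separable_imp_second_countable
      completely_metrizable_imp_metrizable_space)

lemma polish_space_imp_Hausdorff_space: "polish_space X \<Longrightarrow> Hausdorff_space X"
  by (simp add: polish_space_def completely_metrizable_imp_metrizable_space
      metrizable_imp_Hausdorff_space)

lemma polish_space_countable_base: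
  assumes "polish_space X"
  obtains \<B> where "countable_base X \<B>"
  using polish_space_imp_second_countable[OF assms] second_countable_iff_countable_base by blast

lemma space_borel_of [simp]: "space (borel_of X) = topspace X"
  unfolding borel_of_def by (rule space_measure_of) (auto dest: openin_subset)

lemma sets_borel_of: "sets (borel_of X) = sigma_sets (topspace X) {U. openin X U}"
  unfolding borel_of_def by (rule sets_measure_of) (auto dest: openin_subset)

lemma openin_borel_of: "openin X U \<Longrightarrow> U \<in> sets (borel_of X)"
  by (auto simp: sets_borel_of)

lemma closedin_borel_of:
  assumes "closedin X C"
  shows "C \<in> sets (borel_of X)"
proof -
  have "space (borel_of X) - (topspace X - C) \<in> sets (borel_of X)"
    using assms by (intro sets.compl_sets openin_borel_of) (simp add: closedin_def)
  then show ?thesis using closedin_subset[OF assms] by (simp add: double_diff)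
qed

lemma sets_borel_of_countable_base:
  assumes \<B>: "countable_base X \<B>"
  shows "sets (borel_of X) = sigma_sets (topspace X) \<B>"
proof
  have "U \<in> sigma_sets (topspace X) \<B>" if "openin X U" for U
  proof -
    have "\<Union>{V \<in> \<B>. V \<subseteq> U} \<in> sigma_sets (topspace X) \<B>"
      using countable_base_countable[OF \<B>]
      by (intro sigma_sets_UNION) auto
    then show ?thesis using countable_base_Union[OF \<B> that] by simp
  qed
  then show "sets (borel_of X) \<subseteq> sigma_sets (topspace X) \<B>"
    unfolding sets_borel_of by (intro sigma_sets_mono) auto
  show "sigma_sets (topspace X) \<B> \<subseteq> sets (borel_of X)"
    unfolding sets_borel_of using \<B> by (intro sigma_sets_mono) (auto dest: countable_base_openin)
qed

lemma measurable_borel_of_countable_base: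
  assumes \<B>: "countable_base X \<B>"
    and "\<And>x. x \<in> space N \<Longrightarrow> f x \<in> topspace X"
    and "\<And>V. V \<in> \<B> \<Longrightarrow> f -` V \<inter> space N \<in> sets N"
  shows "f \<in> N \<rightarrow>\<^sub>M borel_of X"
  using assms(2,3) openin_subset[OF countable_base_openin[OF \<B>]]
  by (intro measurable_sigma_sets[OF sets_borel_of_countable_base[OF \<B>]]) auto

lemma continuous_map_measurable:
  assumes "continuous_map X Y f"
  shows "f \<in> borel_of X \<rightarrow>\<^sub>M borel_of Y"
proof (rule measurable_sigma_sets[OF sets_borel_of])
  fix U assume "U \<in> {U. openin Y U}"
  then have "openin X {x \<in> topspace X. f x \<in> U}"
    using assms by (simp add: openin_continuous_map_preimage)
  moreover have "{x \<in> topspace X. f x \<in> U} = f -` U \<inter> space (borel_of X)" by auto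
  ultimately show "f -` U \<inter> space (borel_of X) \<in> sets (borel_of X)"
    by (metis openin_borel_of)
qed (use assms in \<open>auto simp: continuous_map_def Pi_iff dest: openin_subset\<close>)

lemma measurable_Pair_borel_of:
  assumes X: "second_countable X" and Y: "second_countable Y"
    and f: "f \<in> N \<rightarrow>\<^sub>M borel_of X" and g: "g \<in> N \<rightarrow>\<^sub>M borel_of Y"
  shows "(\<lambda>x. (f x, g x)) \<in> N \<rightarrow>\<^sub>M borel_of (prod_topology X Y)"
proof -
  obtain \<B> \<C> where \<B>: "countable_base X \<B>" and \<C>: "countable_base Y \<C>"
    using X Y unfolding second_countable_iff_countable_base by blast
  show ?thesis
  proof (rule measurable_borel_of_countable_base[OF countable_base_prod[OF \<B> \<C>]])
    fix x assume "x \<in> space N"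
    then show "(f x, g x) \<in> topspace (prod_topology X Y)"
      using measurable_space[OF f] measurable_space[OF g] by simp
  next
    fix Q assume "Q \<in> (\<lambda>(V, W). V \<times> W) ` (\<B> \<times> \<C>)"
    then obtain V W where Q: "Q = V \<times> W" and "V \<in> \<B>" "W \<in> \<C>" by auto
    then have "V \<in> sets (borel_of X)" "W \<in> sets (borel_of Y)"
      using \<B> \<C> by (auto intro: openin_borel_of dest: countable_base_openin)
    then have "(f -` V \<inter> space N) \<inter> (g -` W \<inter> space N) \<in> sets N"
      by (intro sets.Int measurable_sets[OF f] measurable_sets[OF g])
    moreover have "(\<lambda>x. (f x, g x)) -` Q \<inter> space N = (f -` V \<inter> space N) \<inter> (g -` W \<inter> space N)"
      by (auto simp: Q)
    ultimately show "(\<lambda>x. (f x, g x)) -` Q \<inter> space N \<in> sets N" by simp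
  qed
qed

lemma sets_Collect_eq_borel_of:
  assumes X: "second_countable X" "Hausdorff_space X"
    and f: "f \<in> N \<rightarrow>\<^sub>M borel_of X" and g: "g \<in> N \<rightarrow>\<^sub>M borel_of X"
  shows "{x \<in> space N. f x = g x} \<in> sets N"
proof -
  let ?D = "(\<lambda>x. (x, x)) ` topspace X"
  have "closedin (prod_topology X X) ?D"
    using X(2) by (simp add: Hausdorff_space_closedin_diagonal)
  then have "(\<lambda>x. (f x, g x)) -` ?D \<inter> space N \<in> sets N"
    by (intro measurable_sets[OF measurable_Pair_borel_of[OF X(1) X(1) f g]] closedin_borel_of)
  moreover have "(\<lambda>x. (f x, g x)) -` ?D \<inter> space N = {x \<in> space N. f x = g x}"
    using measurable_space[OF f] by (auto simp: image_iff) metis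
  ultimately show ?thesis by simp
qed

lemma pred_countable_Bex:
  assumes "countable I" "\<And>i. i \<in> I \<Longrightarrow> Measurable.pred N (P i)"
  shows "Measurable.pred N (\<lambda>x. \<exists>i\<in>I. P i x)"
  using assms unfolding pred_def by (intro sets.sets_Collect_countable_Ex')

lemma pred_countable_Ball:
  assumes "countable I" "\<And>i. i \<in> I \<Longrightarrow> Measurable.pred N (P i)"
  shows "Measurable.pred N (\<lambda>x. \<forall>i\<in>I. P i x)"
  using assms unfolding pred_def by (intro sets.sets_Collect_countable_All')

section \<open>Meager sets and the Baire property\<close>

definition dense_openin :: "'a topology \<Rightarrow> 'a set \<Rightarrow> bool" where
  "dense_openin T D \<longleftrightarrow> openin T D \<and> (\<forall>U. openin T U \<and> U \<noteq> {} \<longrightarrow> D \<inter> U \<noteq> {})"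

definition meager_in :: "'a topology \<Rightarrow> 'a set \<Rightarrow> bool" where
  "meager_in T S \<longleftrightarrow> (\<exists>\<D>. countable \<D> \<and> (\<forall>D\<in>\<D>. dense_openin T D) \<and> S \<inter> \<Inter>\<D> = {})"

lemma meager_in_subset: "meager_in T S \<Longrightarrow> S' \<subseteq> S \<Longrightarrow> meager_in T S'"
  unfolding meager_in_def by (elim exE conjE, intro exI conjI) auto

lemma meager_in_empty [simp]: "meager_in T {}"
  unfolding meager_in_def by (intro exI[of _ "{}"]) simp

lemma meager_in_UN:
  assumes "countable I" "\<And>i. i \<in> I \<Longrightarrow> meager_in T (S i)"
  shows "meager_in T (\<Union>i\<in>I. S i)"
proof -
  obtain \<D> where \<D>: "\<And>i. i \<in> I \<Longrightarrow>
      countable (\<D> i) \<and> (\<forall>D\<in>\<D> i. dense_openin T D) \<and> S i \<inter> \<Inter>(\<D> i) = {}"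
    using assms(2) unfolding meager_in_def by metis
  have "(\<Union>i\<in>I. S i) \<inter> \<Inter>(\<Union>i\<in>I. \<D> i) \<subseteq> (\<Union>i\<in>I. S i \<inter> \<Inter>(\<D> i))"
    by auto
  then have "(\<Union>i\<in>I. S i) \<inter> \<Inter>(\<Union>i\<in>I. \<D> i) = {}"
    using \<D> by auto
  then show ?thesis
    unfolding meager_in_def using \<D> assms(1)
    by (intro exI[of _ "\<Union>i\<in>I. \<D> i"]) auto
qed

lemma meager_in_UN_iff:
  "countable I \<Longrightarrow> meager_in T (\<Union>i\<in>I. S i) \<longleftrightarrow> (\<forall>i\<in>I. meager_in T (S i))"
  by (meson UN_upper meager_in_UN meager_in_subset)

lemma meager_in_Un: "meager_in T S \<Longrightarrow> meager_in T S' \<Longrightarrow> meager_in T (S \<union> S')"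
  using meager_in_UN[of "{S, S'}" T "\<lambda>S. S"] by auto

lemma openin_not_meager_in:
  assumes "completely_metrizable_space T" "openin T U" "U \<noteq> {}"
  shows "\<not> meager_in T U"
proof
  assume "meager_in T U"
  then obtain \<D> where \<D>: "countable \<D>" "\<forall>D\<in>\<D>. dense_openin T D" "U \<inter> \<Inter>\<D> = {}"
    unfolding meager_in_def by blast
  have "\<forall>V. openin T V \<and> V \<noteq> {} \<longrightarrow> \<Inter>\<D> \<inter> V \<noteq> {}"
    using \<D>(1,2) assms(1) unfolding dense_intersects_open[symmetric] dense_openin_def
    by (intro Baire_category) auto
  then show False using \<D>(3) assms(2,3) by (simp add: Int_commute)
qed

lemma meager_in_boundary:
  assumes "openin T U"
  shows "meager_in T (topspace T - (U \<union> T interior_of (topspace T - U)))"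
proof -
  let ?D = "U \<union> T interior_of (topspace T - U)"
  have "?D \<inter> V \<noteq> {}" if V: "openin T V" "V \<noteq> {}" for V
  proof (cases "U \<inter> V = {}")
    case True
    then have "V \<subseteq> T interior_of (topspace T - U)"
      using openin_subset[OF V(1)] by (intro interior_of_maximal V) auto
    then show ?thesis using V(2) by auto
  qed auto
  then have "dense_openin T ?D" using assms by (simp add: dense_openin_def openin_Un)
  then show ?thesis unfolding meager_in_def by (intro exI[of _ "{?D}"]) auto
qed

lemma meager_in_preimage:
  assumes cont: "continuous_map T T' \<rho>" and "open": "open_map T T' \<rho>" and S: "meager_in T' S"
  shows "meager_in T {x \<in> topspace T. \<rho> x \<in> S}"
proof -
  let ?pre = "\<lambda>D. {x \<in> topspace T. \<rho> x \<in> D}"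
  obtain \<D> where \<D>: "countable \<D>" "\<forall>D\<in>\<D>. dense_openin T' D" "S \<inter> \<Inter>\<D> = {}"
    using S unfolding meager_in_def by blast
  have "dense_openin T (?pre D)" if "dense_openin T' D" for D
    unfolding dense_openin_def
  proof (intro conjI allI impI)
    show "openin T (?pre D)"
      using that cont by (simp add: dense_openin_def openin_continuous_map_preimage)
    fix V assume V: "openin T V \<and> V \<noteq> {}"
    then have "openin T' (\<rho> ` V)" using "open" by (simp add: open_map_def)
    then have "D \<inter> \<rho> ` V \<noteq> {}" using that V by (simp add: dense_openin_def)
    then show "?pre D \<inter> V \<noteq> {}" using openin_subset[of T V] V by auto
  qed
  then show ?thesis
    unfolding meager_in_def using \<D> by (intro exI[of _ "?pre ` \<D>"]) auto
qed

definition baire_property :: "'a topology \<Rightarrow> 'a set \<Rightarrow> bool" where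
  "baire_property T S \<longleftrightarrow> (\<exists>U. openin T U \<and> meager_in T (sym_diff S U))"

lemma openin_baire_property: "openin T U \<Longrightarrow> baire_property T U"
  unfolding baire_property_def by (intro exI[of _ U]) simp

lemma baire_property_compl:
  assumes "baire_property T S"
  shows "baire_property T (topspace T - S)"
proof -
  obtain U where U: "openin T U" "meager_in T (sym_diff S U)"
    using assms unfolding baire_property_def by blast
  let ?E = "T interior_of (topspace T - U)"
  have "meager_in T (sym_diff S U \<union> (topspace T - (U \<union> ?E)))"
    by (intro meager_in_Un meager_in_boundary U)
  moreover have "?E \<subseteq> topspace T - U" by (rule interior_of_subset)
  ultimately have "meager_in T (sym_diff (topspace T - S) ?E)"
    by (elim meager_in_subset) auto
  moreover have "openin T ?E" by simp
  ultimately show ?thesis unfolding baire_property_def by blast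
qed

lemma baire_property_UN:
  assumes "countable I" "\<And>i. i \<in> I \<Longrightarrow> baire_property T (S i)"
  shows "baire_property T (\<Union>i\<in>I. S i)"
proof -
  obtain U where U: "\<And>i. i \<in> I \<Longrightarrow> openin T (U i) \<and> meager_in T (sym_diff (S i) (U i))"
    using assms(2) unfolding baire_property_def by metis
  have "meager_in T (\<Union>i\<in>I. sym_diff (S i) (U i))"
    using U by (intro meager_in_UN assms(1)) auto
  then have "meager_in T (sym_diff (\<Union>i\<in>I. S i) (\<Union>i\<in>I. U i))"
    by (rule meager_in_subset) auto
  moreover have "openin T (\<Union>i\<in>I. U i)" using U by auto
  ultimately show ?thesis unfolding baire_property_def by blast
qed

lemma borel_imp_baire_property:
  assumes "S \<in> sets (borel_of T)"
  shows "baire_property T S"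
  using assms unfolding sets_borel_of
  by (induction rule: sigma_sets.induct)
    (auto intro: openin_baire_property baire_property_compl baire_property_UN)

lemma baire_property_comeager_open_subset:
  assumes "baire_property T S" "openin T U" "\<not> meager_in T (U \<inter> S)"
  obtains V where "openin T V" "V \<noteq> {}" "V \<subseteq> U" "meager_in T (V - S)"
proof -
  obtain O' where O': "openin T O'" "meager_in T (sym_diff S O')"
    using assms(1) unfolding baire_property_def by blast
  have "U \<inter> O' \<noteq> {}"
  proof
    assume "U \<inter> O' = {}"
    then have "U \<inter> S \<subseteq> sym_diff S O'" by auto
    then show False using assms(3) O'(2) meager_in_subset by blast
  qed
  moreover have "meager_in T (U \<inter> O' - S)"
    by (rule meager_in_subset[OF O'(2)]) auto
  ultimately show thesis using assms(2) O'(1) by (intro that[of "U \<inter> O'"]) auto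
qed

lemma not_meager_in_Diff_iff:
  assumes T: "completely_metrizable_space T" and \<B>: "countable_base T \<B>"
    and S: "baire_property T S" and U: "openin T U"
  shows "\<not> meager_in T (U - S) \<longleftrightarrow> (\<exists>V\<in>\<B>. V \<noteq> {} \<and> V \<subseteq> U \<and> meager_in T (V \<inter> S))"
proof
  assume "\<not> meager_in T (U - S)"
  moreover have "U - S = U \<inter> (topspace T - S)" using openin_subset[OF U] by auto
  ultimately obtain V where V: "openin T V" "V \<noteq> {}" "V \<subseteq> U"
      "meager_in T (V - (topspace T - S))"
    using baire_property_comeager_open_subset[OF baire_property_compl[OF S] U] by auto
  obtain W where W: "W \<in> \<B>" "W \<noteq> {}" "W \<subseteq> V"
    using countable_base_elem[OF \<B> V(1)] V(2) by (metis ex_in_conv)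
  then have "meager_in T (W \<inter> S)" by (intro meager_in_subset[OF V(4)]) auto
  then show "\<exists>V\<in>\<B>. V \<noteq> {} \<and> V \<subseteq> U \<and> meager_in T (V \<inter> S)" using W V(3) by blast
next
  assume "\<exists>V\<in>\<B>. V \<noteq> {} \<and> V \<subseteq> U \<and> meager_in T (V \<inter> S)"
  then obtain V where V: "V \<in> \<B>" "V \<noteq> {}" "V \<subseteq> U" "meager_in T (V \<inter> S)" by blast
  have "\<not> meager_in T V"
    using V countable_base_openin[OF \<B>] by (intro openin_not_meager_in[OF T])
  moreover have "V \<subseteq> (U - S) \<union> (V \<inter> S)" using V(3) by auto
  ultimately show "\<not> meager_in T (U - S)" using V(4) meager_in_Un meager_in_subset by metis
qed

lemma meager_in_Diff_locally:
  assumes T: "completely_metrizable_space T" and \<B>: "countable_base T \<B>"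
    and S: "baire_property T (S - S')" "S \<subseteq> topspace T"
    and local: "\<And>V. V \<in> \<B> \<Longrightarrow> meager_in T (V \<inter> S') \<Longrightarrow> meager_in T (V \<inter> S)"
  shows "meager_in T (S - S')"
proof (rule ccontr)
  assume "\<not> meager_in T (S - S')"
  then obtain V where V: "openin T V" "V \<noteq> {}" "meager_in T (V - (S - S'))"
    using baire_property_comeager_open_subset[OF S(1) openin_topspace] S(2)
    by (metis Diff_subset inf_absorb2 subset_trans)
  obtain W where W: "W \<in> \<B>" "W \<noteq> {}" "W \<subseteq> V"
    using countable_base_elem[OF \<B> V(1)] V(2) by (metis ex_in_conv)
  have "meager_in T (W \<inter> S')" by (rule meager_in_subset[OF V(3)]) (use W in auto)
  then have "meager_in T (W \<inter> S \<union> (V - (S - S')))"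
    using local[OF W(1)] V(3) meager_in_Un by blast
  moreover have "W \<subseteq> W \<inter> S \<union> (V - (S - S'))" using W(3) by auto
  ultimately have "meager_in T W" by (rule meager_in_subset)
  then show False
    using openin_not_meager_in[OF T] countable_base_openin[OF \<B>] W by blast
qed

lemma section_borel_of:
  assumes "B \<in> sets (borel_of (prod_topology T X))" "x \<in> topspace X"
  shows "{f \<in> topspace T. (f, x) \<in> B} \<in> sets (borel_of T)"
proof -
  have "continuous_map T (prod_topology T X) (\<lambda>f. (f, x))"
    using assms(2) by (simp add: continuous_map_pairwise o_def)
  from measurable_sets[OF continuous_map_measurable[OF this] assms(1)]
  show ?thesis by (simp add: vimage_def Int_def conj_commute)
qed

lemma nonmeager_rectangle_section:
  assumes T: "completely_metrizable_space T"
    and U: "openin T U" and V: "openin T V" and W: "openin X W"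
  shows "{x \<in> topspace X. \<not> meager_in T {f \<in> U. (f, x) \<in> V \<times> W}} = (if U \<inter> V = {} then {} else W)"
proof -
  have "{f \<in> U. (f, x) \<in> V \<times> W} = (if x \<in> W then U \<inter> V else {})" for x by auto
  then show ?thesis
    using openin_not_meager_in[OF T openin_Int[OF U V]] openin_subset[OF W] by auto
qed

lemma nonmeager_compl_section:
  assumes T: "completely_metrizable_space T" "countable_base T \<B>"
    and B: "B \<in> sets (borel_of (prod_topology T X))" and U: "openin T U" and x: "x \<in> topspace X"
  shows "\<not> meager_in T {f \<in> U. (f, x) \<in> topspace (prod_topology T X) - B} \<longleftrightarrow>
    (\<exists>V\<in>\<B>. V \<noteq> {} \<and> V \<subseteq> U \<and> meager_in T {f \<in> V. (f, x) \<in> B})"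
proof -
  have "baire_property T {f \<in> topspace T. (f, x) \<in> B}"
    by (rule borel_imp_baire_property[OF section_borel_of[OF B x]])
  note not_meager_in_Diff_iff[OF T this U]
  moreover have "{f \<in> U. (f, x) \<in> topspace (prod_topology T X) - B} =
      U - {f \<in> topspace T. (f, x) \<in> B}"
    using x openin_subset[OF U] by auto
  moreover have "V \<inter> {f \<in> topspace T. (f, x) \<in> B} = {f \<in> V. (f, x) \<in> B}" if "V \<in> \<B>" for V
    using openin_subset[OF countable_base_openin[OF T(2) that]] by auto
  ultimately show ?thesis by simp
qed

lemma nonmeager_section_borel_of:
  assumes T: "completely_metrizable_space T" "countable_base T \<B>" and X: "countable_base X \<C>"
    and B: "B \<in> sets (borel_of (prod_topology T X))" and U: "openin T U"
  shows "{x \<in> topspace X. \<not> meager_in T {f \<in> U. (f, x) \<in> B}} \<in> sets (borel_of X)"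
    (is "?N B U \<in> _")
  using B U unfolding sets_borel_of_countable_base[OF countable_base_prod[OF T(2) X]]
proof (induction arbitrary: U rule: sigma_sets.induct)
  case (Basic B)
  then obtain V W where B: "B = V \<times> W" and V: "openin T V" and W: "openin X W"
    using T(2) X by (auto dest: countable_base_openin)
  show ?case
    unfolding B nonmeager_rectangle_section[OF T(1) Basic.prems V W]
    using openin_borel_of[OF W] by simp
next
  case Empty
  then show ?case by simp
next
  case (Compl B)
  have "B \<in> sets (borel_of (prod_topology T X))"
    using Compl.hyps unfolding sets_borel_of_countable_base[OF countable_base_prod[OF T(2) X]] .
  note nonmeager_compl = nonmeager_compl_section[OF T this Compl.prems]
  have "?N (topspace (prod_topology T X) - B) U =
      (\<Union>V\<in>{V \<in> \<B>. V \<noteq> {} \<and> V \<subseteq> U}. topspace X - ?N B V)"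
    by (simp only: nonmeager_compl cong: conj_cong) blast
  also have "\<dots> \<in> sets (borel_of X)"
  proof (rule sets.countable_UN'')
    show "countable {V \<in> \<B>. V \<noteq> {} \<and> V \<subseteq> U}"
      using countable_base_countable[OF T(2)] by simp
    show "topspace X - ?N B V \<in> sets (borel_of X)" if "V \<in> {V \<in> \<B>. V \<noteq> {} \<and> V \<subseteq> U}" for V
      using that sets.compl_sets[OF Compl.IH[of V]] countable_base_openin[OF T(2), of V] by simp
  qed
  finally show ?case .
next
  case (Union B)
  have "{f \<in> U. (f, x) \<in> (\<Union>i. B i)} = (\<Union>i. {f \<in> U. (f, x) \<in> B i})" for x by auto
  then have "?N (\<Union>i. B i) U = (\<Union>i. ?N (B i) U)" by (auto simp: meager_in_UN_iff)
  then show ?case using Union by auto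
qed

section \<open>Borel actions of Polish groups\<close>

context group_action
begin

lemma action_closed: "g \<in> carrier G \<Longrightarrow> x \<in> E \<Longrightarrow> \<phi> g x \<in> E"
  using element_image by blast

lemma action_one: "x \<in> E \<Longrightarrow> \<phi> \<one> x = x"
  using id_eq_one by (metis restrict_apply')

lemma action_inv: "g \<in> carrier G \<Longrightarrow> x \<in> E \<Longrightarrow> \<phi> (inv g) (\<phi> g x) = x"
  using orbit_sym_aux by blast

end

lemma homeomorphic_map_right_mult:
  assumes G: "topological_group G T" and g: "g \<in> carrier G"
  shows "homeomorphic_map T T (\<lambda>h. h \<otimes>\<^bsub>G\<^esub> g)"
proof -
  interpret group G using G by (simp add: topological_group_def)
  have topspace: "topspace T = carrier G" using G by (simp add: topological_group_def)
  have "continuous_map T T (\<lambda>h. h \<otimes>\<^bsub>G\<^esub> k)" if "k \<in> carrier G" for k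
  proof -
    have "continuous_map T (prod_topology T T) (\<lambda>h. (h, k))"
      using that by (simp add: continuous_map_pairwise o_def topspace)
    then have "continuous_map T T ((\<lambda>(g, h). g \<otimes>\<^bsub>G\<^esub> h) \<circ> (\<lambda>h. (h, k)))"
      using G unfolding topological_group_def by (blast intro: continuous_map_compose)
    then show ?thesis by (simp add: o_def)
  qed
  then have "homeomorphic_maps T T (\<lambda>h. h \<otimes>\<^bsub>G\<^esub> g) (\<lambda>h. h \<otimes>\<^bsub>G\<^esub> inv\<^bsub>G\<^esub> g)"
    using g by (simp add: homeomorphic_maps_def topspace m_assoc)
  then show ?thesis using homeomorphic_map_maps by blast
qed

locale polish_group_action =
  fixes \<Gamma> (structure) and T :: "'g topology" and X :: "'x topology" and \<phi>
  assumes polish_\<Gamma>: "polish_group \<Gamma> T"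
    and polish_X: "polish_space X"
    and borel_action: "borel_action \<Gamma> T X \<phi>"
begin

sublocale group \<Gamma>
  using polish_\<Gamma> by (simp add: polish_group_def topological_group_def)

sublocale group_action \<Gamma> "topspace X" \<phi>
  using borel_action by (simp add: borel_action_def)

lemma topspace_T [simp]: "topspace T = carrier \<Gamma>"
  using polish_\<Gamma> by (simp add: polish_group_def topological_group_def)

lemma topological_group_T: "topological_group \<Gamma> T"
  and polish_T: "polish_space T"
  using polish_\<Gamma> by (simp_all add: polish_group_def)

lemma completely_metrizable_T: "completely_metrizable_space T"
  using polish_T by (simp add: polish_space_def)

lemma measurable_action: "(\<lambda>(g, x). \<phi> g x) \<in> borel_of (prod_topology T X) \<rightarrow>\<^sub>M borel_of X"
  using borel_action by (simp add: borel_action_def)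

lemma action_vimage_borel_of:
  assumes U: "openin X U"
  shows "{p \<in> topspace (prod_topology T X). \<phi> (fst p) (snd p) \<in> U}
    \<in> sets (borel_of (prod_topology T X))"
  using measurable_sets[OF measurable_action openin_borel_of[OF U]]
  by (simp add: vimage_def Int_def conj_commute case_prod_beta)

definition vaught :: "'g set \<Rightarrow> 'x set \<Rightarrow> 'x \<Rightarrow> bool" where
  "vaught V U y \<longleftrightarrow> \<not> meager_in T {g \<in> V. \<phi> g y \<in> U}"

lemma vaught_borel_of:
  assumes V: "openin T V" and U: "openin X U"
  shows "{y \<in> topspace X. vaught V U y} \<in> sets (borel_of X)"
proof -
  obtain \<B> where \<B>: "countable_base T \<B>"
    by (rule polish_space_countable_base[OF polish_T])
  obtain \<C> where \<C>: "countable_base X \<C>"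
    by (rule polish_space_countable_base[OF polish_X])
  let ?B = "{p \<in> topspace (prod_topology T X). \<phi> (fst p) (snd p) \<in> U}"
  have "{g \<in> V. (g, y) \<in> ?B} = {g \<in> V. \<phi> g y \<in> U}" if "y \<in> topspace X" for y
    using that openin_subset[OF V] by auto
  then have "{y \<in> topspace X. vaught V U y} = {y \<in> topspace X. \<not> meager_in T {g \<in> V. (g, y) \<in> ?B}}"
    unfolding vaught_def by (intro Collect_cong conj_cong) simp_all
  also have "\<dots> \<in> sets (borel_of X)"
    by (rule nonmeager_section_borel_of
        [OF completely_metrizable_T \<B> \<C> action_vimage_borel_of[OF U] V])
  finally show ?thesis .
qed

lemma vaught_translate_imp:
  assumes V: "V \<subseteq> carrier \<Gamma>" and g: "g \<in> carrier \<Gamma>" and y: "y \<in> topspace X"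
    and vaught: "vaught V U (\<phi> g y)"
  shows "vaught (V #> g) U y"
proof -
  have "homeomorphic_map T T (\<lambda>h. h \<otimes> g)"
    by (rule homeomorphic_map_right_mult[OF topological_group_T g])
  then have "continuous_map T T (\<lambda>h. h \<otimes> g)" "open_map T T (\<lambda>h. h \<otimes> g)"
    using homeomorphic_imp_continuous_map homeomorphic_imp_open_map by blast+
  moreover have "{h \<in> topspace T. h \<otimes> g \<in> {k \<in> V #> g. \<phi> k y \<in> U}} = {h \<in> V. \<phi> h (\<phi> g y) \<in> U}"
    using V g y by (auto simp: r_coset_def composition_rule subset_iff)
  ultimately show ?thesis
    using vaught meager_in_preimage[of T T "\<lambda>h. h \<otimes> g" "{k \<in> V #> g. \<phi> k y \<in> U}"]
    by (auto simp: vaught_def)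
qed

lemma vaught_translate:
  assumes V: "V \<subseteq> carrier \<Gamma>" and g: "g \<in> carrier \<Gamma>" and y: "y \<in> topspace X"
  shows "vaught V U (\<phi> g y) \<longleftrightarrow> vaught (V #> g) U y"
proof
  assume "vaught (V #> g) U y"
  then have "vaught (V #> g) U (\<phi> (inv g) (\<phi> g y))"
    using g y by (simp add: action_inv)
  then have "vaught (V #> g #> inv g) U (\<phi> g y)"
    by (rule vaught_translate_imp
        [OF r_coset_subset_G[OF V g] inv_closed[OF g] action_closed[OF g y]])
  then show "vaught V U (\<phi> g y)"
    using V g by (simp add: coset_mult_assoc)
qed (rule vaught_translate_imp[OF assms])

lemma vaught_separates:
  assumes \<B>: "countable_base T \<B>" and \<C>: "countable_base X \<C>"
    and y: "y \<in> topspace X" "y' \<in> topspace X"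
    and eq: "\<And>V U. V \<in> \<B> \<Longrightarrow> U \<in> \<C> \<Longrightarrow> vaught V U y \<longleftrightarrow> vaught V U y'"
  shows "y = y'"
proof -
  define R where "R U z = {g \<in> carrier \<Gamma>. \<phi> g z \<in> U}" for U z
  have R: "R U z \<in> sets (borel_of T)" if "openin X U" "z \<in> topspace X" for U z
    using section_borel_of[OF action_vimage_borel_of[OF that(1)] that(2)] that(2)
    by (simp add: R_def)
  have "V \<inter> R U z = {g \<in> V. \<phi> g z \<in> U}" if "V \<in> \<B>" for U V z
    using openin_subset[OF countable_base_openin[OF \<B> that]] by (auto simp: R_def)
  then have "meager_in T (V \<inter> R U y) \<longleftrightarrow> meager_in T (V \<inter> R U y')" if "V \<in> \<B>" "U \<in> \<C>" for U V
    using eq[OF that] that by (simp add: vaught_def)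
  then have "meager_in T (R U y - R U y')" if "U \<in> \<C>" for U
    using that y countable_base_openin[OF \<C> that] R
    by (intro meager_in_Diff_locally[OF completely_metrizable_T \<B>] borel_imp_baire_property
        sets.Diff) (auto simp: R_def)
  then have "meager_in T (\<Union>U\<in>\<C>. R U y - R U y')"
    using \<C> by (intro meager_in_UN countable_base_countable)
  moreover have "\<not> meager_in T (carrier \<Gamma>)"
    using openin_not_meager_in[OF completely_metrizable_T openin_topspace] one_closed by auto
  ultimately have "\<not> carrier \<Gamma> \<subseteq> (\<Union>U\<in>\<C>. R U y - R U y')"
    using meager_in_subset by blast
  then obtain g where g: "g \<in> carrier \<Gamma>" "\<And>U. U \<in> \<C> \<Longrightarrow> \<phi> g y \<in> U \<Longrightarrow> \<phi> g y' \<in> U"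
    by (auto simp: R_def)
  have "\<phi> g y = \<phi> g y'"
    by (rule countable_base_separates[OF \<C> Hausdorff_imp_t1_space])
      (use g y polish_X in \<open>simp_all add: action_closed polish_space_imp_Hausdorff_space\<close>)
  then show ?thesis using action_inv g(1) y by metis
qed

end

subsection \<open>Graphs given by Borel maps into the group\<close>

lemma borel_graph_symmetrization:
  assumes X: "polish_space X" and H: "H \<in> sets (borel_of (prod_topology X X))"
  shows "borel_graph X (H \<union> H\<inverse> - Id)"
proof -
  let ?XX = "prod_topology X X"
  have HX: "H \<subseteq> topspace ?XX" using sets.sets_into_space[OF H] by simp
  have "prod.swap -` H \<inter> space (borel_of ?XX) \<in> sets (borel_of ?XX)"
    by (intro measurable_sets[OF _ H] continuous_map_measurable)
      (simp add: continuous_map_pairwise o_def continuous_map_fst continuous_map_snd)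
  moreover have "{p \<in> space (borel_of ?XX). fst p = snd p} \<in> sets (borel_of ?XX)"
    by (intro sets_Collect_eq_borel_of[OF polish_space_imp_second_countable[OF X]
          polish_space_imp_Hausdorff_space[OF X]] continuous_map_measurable
        continuous_map_fst continuous_map_snd)
  ultimately have "H \<union> (prod.swap -` H \<inter> space (borel_of ?XX)) -
      {p \<in> space (borel_of ?XX). fst p = snd p} \<in> sets (borel_of ?XX)"
    using H by blast
  moreover have "H \<union> (prod.swap -` H \<inter> space (borel_of ?XX)) -
      {p \<in> space (borel_of ?XX). fst p = snd p} = H \<union> H\<inverse> - Id"
    using HX by auto
  ultimately show ?thesis
    by (auto simp: borel_graph_def sym_def irrefl_def)
qed

context polish_group_action
begin

definition mover_graph :: "('x \<Rightarrow> 'g) \<Rightarrow> ('x \<times> 'x) set" where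
  "mover_graph e = {p \<in> topspace X \<times> topspace X. \<phi> (e (snd p)) (fst p) = snd p}"

lemma mover_graph_borel_of:
  assumes e: "e \<in> borel_of X \<rightarrow>\<^sub>M borel_of T"
  shows "mover_graph e \<in> sets (borel_of (prod_topology X X))"
proof -
  let ?XX = "prod_topology X X"
  note second_countable = polish_space_imp_second_countable
  have fst: "fst \<in> borel_of ?XX \<rightarrow>\<^sub>M borel_of X" and snd: "snd \<in> borel_of ?XX \<rightarrow>\<^sub>M borel_of X"
    by (auto intro: continuous_map_measurable continuous_map_fst continuous_map_snd)
  have "(\<lambda>p. (e (snd p), fst p)) \<in> borel_of ?XX \<rightarrow>\<^sub>M borel_of (prod_topology T X)"
    by (intro measurable_Pair_borel_of second_countable polish_T polish_X fst
        measurable_compose[OF snd e])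
  from measurable_compose[OF this measurable_action]
  have "(\<lambda>p. \<phi> (e (snd p)) (fst p)) \<in> borel_of ?XX \<rightarrow>\<^sub>M borel_of X" by simp
  from sets_Collect_eq_borel_of[OF second_countable[OF polish_X]
      polish_space_imp_Hausdorff_space[OF polish_X] this snd]
  show ?thesis by (simp add: mover_graph_def)
qed

lemma mover_graph_subset_orbits:
  assumes e: "e \<in> borel_of X \<rightarrow>\<^sub>M borel_of T" and xy: "(x, y) \<in> mover_graph e"
  shows "y \<in> orbit \<Gamma> \<phi> x"
proof -
  have "y \<in> topspace X" "\<phi> (e y) x = y" using xy by (auto simp: mover_graph_def)
  moreover from this have "e y \<in> carrier \<Gamma>" using measurable_space[OF e, of y] by simp
  ultimately show ?thesis unfolding orbit_def by force
qed

lemma orbit_equivalence_relation_mover_graphs: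
  assumes E: "\<And>e. e \<in> E \<Longrightarrow> e \<in> borel_of X \<rightarrow>\<^sub>M borel_of T"
    and connected: "\<And>x g. x \<in> topspace X \<Longrightarrow> g \<in> carrier \<Gamma> \<Longrightarrow>
      (x, \<phi> g x) \<in> ((\<Union>e\<in>E. mover_graph e) \<union> (\<Union>e\<in>E. mover_graph e)\<inverse>)\<^sup>*"
  shows "orbit_equivalence_relation \<Gamma> X \<phi> =
    connectedness_relation X ((\<Union>e\<in>E. mover_graph e) \<union> (\<Union>e\<in>E. mover_graph e)\<inverse> - Id)"
proof -
  let ?H = "\<Union>e\<in>E. mover_graph e"
  have adjacent: "x \<in> topspace X \<and> y \<in> topspace X \<and> y \<in> orbit \<Gamma> \<phi> x"
    if H: "(x, y) \<in> ?H \<union> ?H\<inverse>" for x y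
  proof -
    have "x \<in> topspace X" "y \<in> topspace X" using H by (auto simp: mover_graph_def)
    moreover have "y \<in> orbit \<Gamma> \<phi> x \<or> x \<in> orbit \<Gamma> \<phi> y"
      using H mover_graph_subset_orbits[OF E] by auto
    ultimately show ?thesis using orbit_sym by blast
  qed
  have "y \<in> topspace X \<and> y \<in> orbit \<Gamma> \<phi> x" if "(x, y) \<in> (?H \<union> ?H\<inverse>)\<^sup>*" "x \<in> topspace X" for x y
    using that(1)
  proof (induction rule: rtrancl_induct)
    case base
    then show ?case using that(2) by (simp add: orbit_refl)
  next
    case (step y z)
    have "z \<in> orbit \<Gamma> \<phi> x"
      by (rule orbit_trans[of x y z]) (use adjacent[OF step.hyps(2)] step.IH that(2) in auto)
    then show ?case using adjacent[OF step.hyps(2)] by blast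
  qed
  moreover have "y \<in> topspace X" "(x, y) \<in> (?H \<union> ?H\<inverse>)\<^sup>*"
    if "x \<in> topspace X" "y \<in> orbit \<Gamma> \<phi> x" for x y
    using that connected action_closed by (auto simp: orbit_def)
  ultimately show ?thesis
    unfolding orbit_equivalence_relation_def connectedness_relation_def rtrancl_r_diff_Id
    by blast
qed

lemma borel_graph_of_mover_graphs:
  assumes E: "countable E" "\<And>e. e \<in> E \<Longrightarrow> e \<in> borel_of X \<rightarrow>\<^sub>M borel_of T"
    and connected: "\<And>x g. x \<in> topspace X \<Longrightarrow> g \<in> carrier \<Gamma> \<Longrightarrow>
      (x, \<phi> g x) \<in> ((\<Union>e\<in>E. mover_graph e) \<union> (\<Union>e\<in>E. mover_graph e)\<inverse>)\<^sup>*"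
  shows "\<exists>H. borel_graph X H \<and> orbit_equivalence_relation \<Gamma> X \<phi> = connectedness_relation X H"
proof -
  have "(\<Union>e\<in>E. mover_graph e) \<in> sets (borel_of (prod_topology X X))"
    using E by (intro sets.countable_UN'' mover_graph_borel_of)
  then show ?thesis
    using borel_graph_symmetrization[OF polish_X]
      orbit_equivalence_relation_mover_graphs[OF E(2) connected] by blast
qed

end

section \<open>Closed permutation groups\<close>

lemma openin_product_topology_discrete_agree:
  assumes R: "R \<in> Fpow I" and f: "f \<in> I \<rightarrow>\<^sub>E B"
  shows "openin (product_topology (\<lambda>_. discrete_topology B) I) {g \<in> I \<rightarrow>\<^sub>E B. \<forall>i\<in>R. g i = f i}"
proof -
  define V where "V i = (if i \<in> R then {f i} else B)" for i
  have RI: "finite R" "R \<subseteq> I" using R by (auto simp: Fpow_def)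
  have VB: "V i \<subseteq> B" if "i \<in> I" for i
    using PiE_mem[OF f that] by (simp add: V_def)
  moreover have "finite {i \<in> I. V i \<noteq> B}"
    by (rule finite_subset[OF _ RI(1)]) (auto simp: V_def)
  ultimately have "openin (product_topology (\<lambda>_. discrete_topology B) I) (Pi\<^sub>E I V)"
    by (simp add: openin_PiE_gen)
  moreover have "Pi\<^sub>E I V = {g \<in> I \<rightarrow>\<^sub>E B. \<forall>i\<in>R. g i = f i}"
  proof (intro equalityI subsetI CollectI conjI ballI)
    fix g assume g: "g \<in> Pi\<^sub>E I V"
    show "g \<in> I \<rightarrow>\<^sub>E B" by (rule subsetD[OF PiE_mono g]) (rule VB)
    show "g i = f i" if "i \<in> R" for i
      using PiE_mem[OF g subsetD[OF RI(2) that]] that by (simp add: V_def)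
  next
    fix g assume "g \<in> {g \<in> I \<rightarrow>\<^sub>E B. \<forall>i\<in>R. g i = f i}"
    then show "g \<in> Pi\<^sub>E I V" by (simp add: V_def PiE_iff)
  qed
  ultimately show ?thesis by simp
qed

lemma openin_product_topology_discrete:
  "openin (product_topology (\<lambda>_. discrete_topology B) I) U \<longleftrightarrow>
     U \<subseteq> I \<rightarrow>\<^sub>E B \<and> (\<forall>f\<in>U. \<exists>R\<in>Fpow I. \<forall>g\<in>I \<rightarrow>\<^sub>E B. (\<forall>i\<in>R. g i = f i) \<longrightarrow> g \<in> U)"
    (is "openin ?P U \<longleftrightarrow> ?determined")
proof
  assume U: "openin ?P U"
  have "\<exists>R\<in>Fpow I. \<forall>g\<in>I \<rightarrow>\<^sub>E B. (\<forall>i\<in>R. g i = f i) \<longrightarrow> g \<in> U" if "f \<in> U" for f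
  proof -
    have "\<exists>V. finite {i \<in> I. V i \<noteq> B} \<and> f \<in> Pi\<^sub>E I V \<and> Pi\<^sub>E I V \<subseteq> U"
      using bspec[OF U[unfolded openin_product_topology_alt topspace_discrete_topology] that]
      by meson
    then obtain V where V: "finite {i \<in> I. V i \<noteq> B}" "f \<in> Pi\<^sub>E I V" "Pi\<^sub>E I V \<subseteq> U"
      by blast
    have "g \<in> U" if g: "g \<in> I \<rightarrow>\<^sub>E B" "\<forall>i\<in>{i \<in> I. V i \<noteq> B}. g i = f i" for g
    proof -
      have "g i \<in> V i" if "i \<in> I" for i
        using g PiE_mem[OF g(1) that] PiE_mem[OF V(2) that] that by (cases "V i = B") auto
      then have "g \<in> Pi\<^sub>E I V" using g(1) by (simp add: PiE_iff)
      then show ?thesis using V(3) by blast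
    qed
    moreover have "{i \<in> I. V i \<noteq> B} \<in> Fpow I" using V(1) by (auto simp: Fpow_def)
    ultimately show ?thesis by blast
  qed
  then show ?determined using openin_subset[OF U] by simp
next
  assume determined: ?determined
  show "openin ?P U"
  proof (subst openin_subopen, intro ballI)
    fix f assume f: "f \<in> U"
    then obtain R where R: "R \<in> Fpow I" and "\<forall>g\<in>I \<rightarrow>\<^sub>E B. (\<forall>i\<in>R. g i = f i) \<longrightarrow> g \<in> U"
      using determined by meson
    then have "{g \<in> I \<rightarrow>\<^sub>E B. \<forall>i\<in>R. g i = f i} \<subseteq> U" by blast
    moreover have fB: "f \<in> I \<rightarrow>\<^sub>E B" using determined f by blast
    then have "f \<in> {g \<in> I \<rightarrow>\<^sub>E B. \<forall>i\<in>R. g i = f i}" by simp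
    ultimately show "\<exists>V. openin ?P V \<and> f \<in> V \<and> V \<subseteq> U"
      using openin_product_topology_discrete_agree[OF R fB] by (intro exI conjI)
  qed
qed

locale closed_perm_group =
  fixes \<Omega> :: "'a set" and A :: "('a \<Rightarrow> 'a) set" and G (structure) and T
  assumes subgroup_A: "subgroup A (BijGroup \<Omega>)"
    and countable_\<Omega>: "countable \<Omega>"
    and closed_A: "\<And>f. f \<in> Bij \<Omega> \<Longrightarrow> (\<And>R. R \<in> Fpow \<Omega> \<Longrightarrow> \<exists>g\<in>A. \<forall>v\<in>R. g v = f v) \<Longrightarrow> f \<in> A"
  defines G_def: "G \<equiv> BijGroup \<Omega> \<lparr>carrier := A\<rparr>"
    and T_def: "T \<equiv> subtopology (product_topology (\<lambda>_. discrete_topology \<Omega>) \<Omega>) A"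
begin

sublocale group G
  unfolding G_def by (rule subgroup.subgroup_is_group[OF subgroup_A group_BijGroup])

lemma carrier_G [simp]: "carrier G = A"
  by (simp add: G_def)

lemma A_Bij: "f \<in> A \<Longrightarrow> f \<in> Bij \<Omega>"
  using subgroup.subset[OF subgroup_A] by (auto simp: BijGroup_def)

lemma A_closed: "f \<in> A \<Longrightarrow> v \<in> \<Omega> \<Longrightarrow> f v \<in> \<Omega>"
  using Bij_imp_funcset[OF A_Bij] by auto

lemma A_map_closed: "f \<in> A \<Longrightarrow> c \<in> lists \<Omega> \<Longrightarrow> map f c \<in> lists \<Omega>"
  using A_closed by auto

lemma A_extensional: "f \<in> A \<Longrightarrow> f \<in> extensional \<Omega>"
  using A_Bij Bij_imp_extensional by blast

lemma A_PiE: "A \<subseteq> \<Omega> \<rightarrow>\<^sub>E \<Omega>"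
  using A_closed A_extensional by (auto simp: PiE_def)

lemma A_ext: "f \<in> A \<Longrightarrow> g \<in> A \<Longrightarrow> (\<And>v. v \<in> \<Omega> \<Longrightarrow> f v = g v) \<Longrightarrow> f = g"
  by (blast intro: extensionalityI A_extensional)

lemma mult_A [simp]: "f \<in> A \<Longrightarrow> g \<in> A \<Longrightarrow> f \<otimes> g \<in> A"
  and one_A [simp]: "\<one> \<in> A"
  and inv_A [simp]: "f \<in> A \<Longrightarrow> inv f \<in> A"
  using m_closed one_closed inv_closed by simp_all

lemma mult_apply: "f \<in> A \<Longrightarrow> g \<in> A \<Longrightarrow> v \<in> \<Omega> \<Longrightarrow> (f \<otimes> g) v = f (g v)"
  by (simp add: G_def BijGroup_def A_Bij compose_eq)

lemma one_apply: "v \<in> \<Omega> \<Longrightarrow> \<one> v = v"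
  by (simp add: G_def BijGroup_def)

lemma inv_apply: "f \<in> A \<Longrightarrow> v \<in> \<Omega> \<Longrightarrow> (inv f) (f v) = v"
  using mult_apply[OF inv_A, of f f v] by (simp add: one_apply)

lemma apply_inv: "f \<in> A \<Longrightarrow> v \<in> \<Omega> \<Longrightarrow> f ((inv f) v) = v"
  using mult_apply[OF _ inv_A, of f f v] by (simp add: one_apply)

lemma map_mult: "f \<in> A \<Longrightarrow> g \<in> A \<Longrightarrow> c \<in> lists \<Omega> \<Longrightarrow> map (f \<otimes> g) c = map f (map g c)"
  by (auto simp: mult_apply)

lemma countable_Fpow_\<Omega>: "countable (Fpow \<Omega>)"
  using countable_\<Omega> countable_Collect_finite_subset[of \<Omega>] by (simp add: Fpow_def conj_commute)

definition nbhd :: "'a set \<Rightarrow> ('a \<Rightarrow> 'a) \<Rightarrow> ('a \<Rightarrow> 'a) set" where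
  "nbhd R f = {g \<in> A. \<forall>v\<in>R. g v = f v}"

lemma nbhd_subset: "nbhd R f \<subseteq> A"
  by (auto simp: nbhd_def)

lemma in_nbhd: "f \<in> A \<Longrightarrow> f \<in> nbhd R f"
  by (simp add: nbhd_def)

lemma in_A_iff:
  "f \<in> A \<longleftrightarrow> f \<in> \<Omega> \<rightarrow>\<^sub>E \<Omega> \<and> \<Omega> \<subseteq> f ` \<Omega> \<and> (\<forall>R\<in>Fpow \<Omega>. nbhd R f \<noteq> {})"
proof
  assume f: "f \<in> A"
  then have "f ` \<Omega> = \<Omega>" using A_Bij by (simp add: Bij_def bij_betw_def)
  then show "f \<in> \<Omega> \<rightarrow>\<^sub>E \<Omega> \<and> \<Omega> \<subseteq> f ` \<Omega> \<and> (\<forall>R\<in>Fpow \<Omega>. nbhd R f \<noteq> {})"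
    using f A_PiE in_nbhd by blast
next
  assume f: "f \<in> \<Omega> \<rightarrow>\<^sub>E \<Omega> \<and> \<Omega> \<subseteq> f ` \<Omega> \<and> (\<forall>R\<in>Fpow \<Omega>. nbhd R f \<noteq> {})"
  have "inj_on f \<Omega>"
  proof (rule inj_onI)
    fix v w assume vw: "v \<in> \<Omega>" "w \<in> \<Omega>" "f v = f w"
    then have "nbhd {v, w} f \<noteq> {}" using f by (simp add: Fpow_def)
    then obtain g where "g \<in> nbhd {v, w} f" by blast
    then have "g \<in> A" "g v = g w" using vw(3) by (auto simp: nbhd_def)
    then show "v = w" using vw inv_apply by metis
  qed
  then have "f \<in> Bij \<Omega>" using f by (auto simp: Bij_def bij_betw_def PiE_def)
  then show "f \<in> A"
  proof (rule closed_A)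
    fix R assume "R \<in> Fpow \<Omega>"
    then obtain g where "g \<in> nbhd R f" using f by blast
    then show "\<exists>g\<in>A. \<forall>v\<in>R. g v = f v" unfolding nbhd_def by blast
  qed
qed

lemma topspace_T [simp]: "topspace T = A"
  using A_PiE by (auto simp: T_def)

lemma openin_T_iff: "openin T U \<longleftrightarrow> U \<subseteq> A \<and> (\<forall>f\<in>U. \<exists>R\<in>Fpow \<Omega>. nbhd R f \<subseteq> U)"
proof
  assume "openin T U"
  then obtain V where V: "openin (product_topology (\<lambda>_. discrete_topology \<Omega>) \<Omega>) V" "U = V \<inter> A"
    unfolding T_def openin_subtopology by blast
  have "\<exists>R\<in>Fpow \<Omega>. nbhd R f \<subseteq> U" if "f \<in> U" for f
  proof -
    have "f \<in> V" using that V(2) by simp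
    then obtain R where "R \<in> Fpow \<Omega>" and R: "\<forall>g\<in>\<Omega> \<rightarrow>\<^sub>E \<Omega>. (\<forall>v\<in>R. g v = f v) \<longrightarrow> g \<in> V"
      using V(1) unfolding openin_product_topology_discrete by meson
    moreover have "nbhd R f \<subseteq> U"
      using R V(2) A_PiE unfolding nbhd_def by blast
    ultimately show ?thesis by blast
  qed
  then show "U \<subseteq> A \<and> (\<forall>f\<in>U. \<exists>R\<in>Fpow \<Omega>. nbhd R f \<subseteq> U)" using V(2) by simp
next
  assume U: "U \<subseteq> A \<and> (\<forall>f\<in>U. \<exists>R\<in>Fpow \<Omega>. nbhd R f \<subseteq> U)"
  define V where "V = {h \<in> \<Omega> \<rightarrow>\<^sub>E \<Omega>. \<exists>f\<in>U. \<exists>R\<in>Fpow \<Omega>. nbhd R f \<subseteq> U \<and> (\<forall>v\<in>R. h v = f v)}"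
  have "openin (product_topology (\<lambda>_. discrete_topology \<Omega>) \<Omega>) V"
    unfolding openin_product_topology_discrete
  proof (intro conjI ballI)
    fix h assume "h \<in> V"
    then obtain f R where fR: "f \<in> U" "R \<in> Fpow \<Omega>" "nbhd R f \<subseteq> U" "\<forall>v\<in>R. h v = f v"
      by (auto simp: V_def)
    have "g \<in> V" if "g \<in> \<Omega> \<rightarrow>\<^sub>E \<Omega>" "\<forall>v\<in>R. g v = h v" for g
      unfolding V_def using that fR by auto
    then show "\<exists>R\<in>Fpow \<Omega>. \<forall>g\<in>\<Omega> \<rightarrow>\<^sub>E \<Omega>. (\<forall>v\<in>R. g v = h v) \<longrightarrow> g \<in> V" using fR(2) by blast
  qed (auto simp: V_def)
  moreover have "V \<inter> A \<subseteq> U" by (auto simp: V_def nbhd_def)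
  moreover have "U \<subseteq> V \<inter> A" using U A_PiE unfolding V_def by blast
  ultimately have "openin (product_topology (\<lambda>_. discrete_topology \<Omega>) \<Omega>) V" "U = V \<inter> A"
    by blast+
  then show "openin T U" unfolding T_def openin_subtopology by blast
qed

lemma openin_nbhd:
  assumes "R \<in> Fpow \<Omega>"
  shows "openin T (nbhd R f)"
proof -
  have "nbhd R g \<subseteq> nbhd R f" if "g \<in> nbhd R f" for g
    using that by (auto simp: nbhd_def)
  then show ?thesis using assms nbhd_subset unfolding openin_T_iff by blast
qed

definition cylinder :: "'a list \<Rightarrow> 'a list \<Rightarrow> ('a \<Rightarrow> 'a) set" where
  "cylinder c a = {f \<in> A. map f c = a}"

lemma openin_cylinder:
  assumes "c \<in> lists \<Omega>"
  shows "openin T (cylinder c a)"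
proof -
  have "nbhd (set c) f \<subseteq> cylinder c a" if "f \<in> cylinder c a" for f
    using that by (auto simp: nbhd_def cylinder_def)
  moreover have "set c \<in> Fpow \<Omega>" using assms by (auto simp: Fpow_def)
  moreover have "cylinder c a \<subseteq> A" by (auto simp: cylinder_def)
  ultimately show ?thesis unfolding openin_T_iff by blast
qed

lemma countable_base_cylinders:
  "countable_base T ((\<lambda>(c, a). cylinder c a) ` (lists \<Omega> \<times> lists \<Omega>))"
  unfolding countable_base_def
proof (intro conjI allI impI ballI)
  show "countable ((\<lambda>(c, a). cylinder c a) ` (lists \<Omega> \<times> lists \<Omega>))"
    using countable_\<Omega> by (intro countable_image countable_SIGMA countable_lists)
  show "openin T V" if "V \<in> (\<lambda>(c, a). cylinder c a) ` (lists \<Omega> \<times> lists \<Omega>)" for V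
    using that openin_cylinder by auto
  fix U f assume "openin T U \<and> f \<in> U"
  then obtain R where f: "f \<in> U" "f \<in> A" and R: "R \<in> Fpow \<Omega>" "nbhd R f \<subseteq> U"
    unfolding openin_T_iff by blast
  obtain c where c: "set c = R" using R(1) finite_list by (auto simp: Fpow_def)
  then have "c \<in> lists \<Omega>" using R(1) by (auto simp: Fpow_def)
  then have "(c, map f c) \<in> lists \<Omega> \<times> lists \<Omega>" using A_map_closed f(2) by blast
  then have "cylinder c (map f c) \<in> (\<lambda>(c, a). cylinder c a) ` (lists \<Omega> \<times> lists \<Omega>)"
    by (rule rev_image_eqI) simp
  moreover have "f \<in> cylinder c (map f c)" using f(2) by (simp add: cylinder_def)
  moreover have "cylinder c (map f c) \<subseteq> U"
    using c R(2) by (auto simp: cylinder_def nbhd_def)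
  ultimately show "\<exists>V\<in>(\<lambda>(c, a). cylinder c a) ` (lists \<Omega> \<times> lists \<Omega>). f \<in> V \<and> V \<subseteq> U"
    by (intro bexI[of _ "cylinder c (map f c)"] conjI)
qed

lemma cylinder_r_coset:
  assumes g: "g \<in> A" and c: "c \<in> lists \<Omega>"
  shows "cylinder (map g c) a #> g = cylinder c a"
proof -
  have "f \<in> cylinder (map g c) a #> g" if f: "f \<in> cylinder c a" for f
  proof -
    have "f \<otimes> inv g \<in> cylinder (map g c) a"
      using f g c by (auto simp: cylinder_def mult_apply A_closed inv_apply)
    moreover have "f = (f \<otimes> inv g) \<otimes> g"
      using f g by (simp add: cylinder_def m_assoc)
    ultimately show ?thesis unfolding r_coset_def by blast
  qed
  moreover have "f \<otimes> g \<in> cylinder c a" if "f \<in> cylinder (map g c) a" for f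
    using that g c map_mult[of f g c] by (simp add: cylinder_def)
  ultimately show ?thesis unfolding r_coset_def by blast
qed

lemma second_countable_T: "second_countable T"
  using countable_base_cylinders second_countable_iff_countable_base by blast

lemma continuous_mult: "continuous_map (prod_topology T T) T (\<lambda>(f, g). f \<otimes> g)"
  unfolding continuous_map_def
proof (intro conjI allI impI)
  fix U assume U: "openin T U"
  let ?pre = "{p \<in> topspace (prod_topology T T). (case p of (f, g) \<Rightarrow> f \<otimes> g) \<in> U}"
  show "openin (prod_topology T T) ?pre"
    unfolding openin_prod_topology_alt
  proof (intro allI impI)
    fix f g assume "(f, g) \<in> ?pre"
    then have fg: "f \<in> A" "g \<in> A" "f \<otimes> g \<in> U" by auto
    then obtain R where R: "R \<in> Fpow \<Omega>" "nbhd R (f \<otimes> g) \<subseteq> U" using U openin_T_iff by blast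
    have gR: "g ` R \<in> Fpow \<Omega>" using R(1) A_closed[OF fg(2)] by (auto simp: Fpow_def)
    have "f' \<otimes> g' \<in> nbhd R (f \<otimes> g)" if "f' \<in> nbhd (g ` R) f" "g' \<in> nbhd R g" for f' g'
      using that fg R(1) by (auto simp: nbhd_def mult_apply Fpow_def subset_iff)
    then have "nbhd (g ` R) f \<times> nbhd R g \<subseteq> ?pre"
      using R(2) by (auto simp: nbhd_def)
    then show "\<exists>V W. openin T V \<and> openin T W \<and> f \<in> V \<and> g \<in> W \<and> V \<times> W \<subseteq> ?pre"
      by (intro exI[of _ "nbhd (g ` R) f"] exI[of _ "nbhd R g"] conjI openin_nbhd in_nbhd
          gR R(1) fg)
  qed
qed auto

lemma continuous_inv: "continuous_map T T (\<lambda>f. inv f)"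
  unfolding continuous_map_def
proof (intro conjI allI impI)
  fix U assume U: "openin T U"
  show "openin T {f \<in> topspace T. inv f \<in> U}"
    unfolding openin_T_iff
  proof (intro conjI ballI)
    fix f assume "f \<in> {f \<in> topspace T. inv f \<in> U}"
    then have f: "f \<in> A" "inv f \<in> U" by auto
    then obtain R where R: "R \<in> Fpow \<Omega>" "nbhd R (inv f) \<subseteq> U" using U openin_T_iff by blast
    have "inv g \<in> nbhd R (inv f)" if g: "g \<in> nbhd ((inv f) ` R) f" for g
    proof -
      have "(inv g) v = (inv f) v" if "v \<in> R" for v
      proof -
        have v: "v \<in> \<Omega>" using R(1) that by (auto simp: Fpow_def)
        then have "g ((inv f) v) = v" using g f(1) that by (simp add: nbhd_def apply_inv)
        then show ?thesis
          using g f(1) v inv_apply[of g "(inv f) v"] by (simp add: nbhd_def A_closed)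
      qed
      then show ?thesis using g by (simp add: nbhd_def)
    qed
    then have "nbhd ((inv f) ` R) f \<subseteq> {f \<in> topspace T. inv f \<in> U}"
      using R(2) by (auto dest: subsetD[OF nbhd_subset])
    moreover have "(inv f) ` R \<in> Fpow \<Omega>"
      using R(1) A_closed[OF inv_A[OF f(1)]] by (auto simp: Fpow_def)
    ultimately show "\<exists>R\<in>Fpow \<Omega>. nbhd R f \<subseteq> {f \<in> topspace T. inv f \<in> U}" by (rule bexI)
  qed auto
qed auto

lemma openin_attains:
  "openin (product_topology (\<lambda>_. discrete_topology \<Omega>) \<Omega>) {f \<in> \<Omega> \<rightarrow>\<^sub>E \<Omega>. u \<in> f ` \<Omega>}"
  unfolding openin_product_topology_discrete
proof (intro conjI ballI)
  fix f assume "f \<in> {f \<in> \<Omega> \<rightarrow>\<^sub>E \<Omega>. u \<in> f ` \<Omega>}"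
  then obtain v where v: "v \<in> \<Omega>" "f v = u" by auto
  then have "\<forall>g\<in>\<Omega> \<rightarrow>\<^sub>E \<Omega>. (\<forall>w\<in>{v}. g w = f w) \<longrightarrow> g \<in> {f \<in> \<Omega> \<rightarrow>\<^sub>E \<Omega>. u \<in> f ` \<Omega>}"
    by (auto intro: rev_image_eqI[OF v(1)])
  moreover have "{v} \<in> Fpow \<Omega>" using v(1) by (simp add: Fpow_def)
  ultimately show "\<exists>R\<in>Fpow \<Omega>. \<forall>g\<in>\<Omega> \<rightarrow>\<^sub>E \<Omega>. (\<forall>v\<in>R. g v = f v) \<longrightarrow> g \<in> {f \<in> \<Omega> \<rightarrow>\<^sub>E \<Omega>. u \<in> f ` \<Omega>}"
    by (rule bexI)
qed auto

lemma openin_nbhd_nonempty: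
  assumes R: "R \<in> Fpow \<Omega>"
  shows "openin (product_topology (\<lambda>_. discrete_topology \<Omega>) \<Omega>) {f \<in> \<Omega> \<rightarrow>\<^sub>E \<Omega>. nbhd R f \<noteq> {}}"
  unfolding openin_product_topology_discrete
proof (intro conjI ballI)
  fix f assume f: "f \<in> {f \<in> \<Omega> \<rightarrow>\<^sub>E \<Omega>. nbhd R f \<noteq> {}}"
  have "g \<in> {f \<in> \<Omega> \<rightarrow>\<^sub>E \<Omega>. nbhd R f \<noteq> {}}" if "g \<in> \<Omega> \<rightarrow>\<^sub>E \<Omega>" "\<forall>v\<in>R. g v = f v" for g
  proof -
    have "nbhd R g = nbhd R f" using that(2) by (simp add: nbhd_def)
    then show ?thesis using f that(1) by simp
  qed
  then have "\<forall>g\<in>\<Omega> \<rightarrow>\<^sub>E \<Omega>. (\<forall>v\<in>R. g v = f v) \<longrightarrow> g \<in> {f \<in> \<Omega> \<rightarrow>\<^sub>E \<Omega>. nbhd R f \<noteq> {}}" by blast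
  then show "\<exists>R'\<in>Fpow \<Omega>. \<forall>g\<in>\<Omega> \<rightarrow>\<^sub>E \<Omega>. (\<forall>v\<in>R'. g v = f v) \<longrightarrow> g \<in> {f \<in> \<Omega> \<rightarrow>\<^sub>E \<Omega>. nbhd R f \<noteq> {}}"
    using R by (rule bexI)
qed auto

lemma gdelta_in_A: "gdelta_in (product_topology (\<lambda>_. discrete_topology \<Omega>) \<Omega>) A"
proof -
  let ?P = "product_topology (\<lambda>_. discrete_topology \<Omega>) \<Omega>"
  define \<U> where "\<U> = insert (\<Omega> \<rightarrow>\<^sub>E \<Omega>)
    ((\<lambda>u. {f \<in> \<Omega> \<rightarrow>\<^sub>E \<Omega>. u \<in> f ` \<Omega>}) ` \<Omega> \<union> (\<lambda>R. {f \<in> \<Omega> \<rightarrow>\<^sub>E \<Omega>. nbhd R f \<noteq> {}}) ` Fpow \<Omega>)"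
  have "openin ?P (\<Omega> \<rightarrow>\<^sub>E \<Omega>)"
    using openin_topspace[of ?P] by simp
  then have "gdelta_in ?P U" if "U \<in> \<U>" for U
    using that openin_attains openin_nbhd_nonempty by (auto simp: \<U>_def intro!: open_imp_gdelta_in)
  moreover have "countable \<U>"
    unfolding \<U>_def using countable_\<Omega> countable_Fpow_\<Omega> by simp
  moreover have "\<U> \<noteq> {}" by (simp add: \<U>_def)
  ultimately have "gdelta_in ?P (\<Inter>\<U>)" by (intro gdelta_in_Inter)
  moreover have "\<Inter>\<U> = A"
  proof (rule Set.set_eqI)
    fix f
    have "f \<in> \<Inter>\<U> \<longleftrightarrow> f \<in> \<Omega> \<rightarrow>\<^sub>E \<Omega> \<and> (\<forall>u\<in>\<Omega>. f \<in> {f \<in> \<Omega> \<rightarrow>\<^sub>E \<Omega>. u \<in> f ` \<Omega>}) \<and>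
        (\<forall>R\<in>Fpow \<Omega>. f \<in> {f \<in> \<Omega> \<rightarrow>\<^sub>E \<Omega>. nbhd R f \<noteq> {}})"
      by (simp add: \<U>_def ball_Un)
    also have "\<dots> \<longleftrightarrow> f \<in> A"
      by (subst in_A_iff) blast
    finally show "f \<in> \<Inter>\<U> \<longleftrightarrow> f \<in> A" .
  qed
  ultimately show ?thesis by simp
qed

lemma polish_group_T: "polish_group G T"
proof -
  have "countable {i \<in> \<Omega>. \<not> (\<exists>a. topspace (discrete_topology \<Omega>) \<subseteq> {a})}"
    by (rule countable_subset[OF _ countable_\<Omega>]) auto
  then have "completely_metrizable_space (product_topology (\<lambda>_. discrete_topology \<Omega>) \<Omega>)"
    unfolding completely_metrizable_space_product_topology
    by (intro disjI2) (simp add: completely_metrizable_space_discrete_topology)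
  then have "completely_metrizable_space T"
    unfolding T_def using gdelta_in_A by (rule completely_metrizable_space_gdelta_in)
  then have "polish_space T"
    using second_countable_T second_countable_imp_separable_space by (simp add: polish_space_def)
  then show ?thesis
    using continuous_mult continuous_inv by (simp add: polish_group_def topological_group_def)
qed

lemma countable_dense_subset:
  assumes "H \<subseteq> A"
  obtains D where "countable D" "D \<subseteq> H" "\<forall>h\<in>H. \<forall>R\<in>Fpow \<Omega>. D \<inter> nbhd R h \<noteq> {}"
proof -
  have "separable_space (subtopology T H)"
    by (intro second_countable_imp_separable_space second_countable_subtopology second_countable_T)
  then obtain D where D: "countable D" "D \<subseteq> H"
      "\<forall>U. openin (subtopology T H) U \<and> U \<noteq> {} \<longrightarrow> D \<inter> U \<noteq> {}"
    unfolding separable_space_def dense_intersects_open by auto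
  have "D \<inter> nbhd R h \<noteq> {}" if "h \<in> H" "R \<in> Fpow \<Omega>" for h R
  proof -
    have "openin (subtopology T H) (nbhd R h \<inter> H)"
      unfolding openin_subtopology using openin_nbhd[OF that(2)] by blast
    moreover have "h \<in> nbhd R h \<inter> H" using that(1) assms in_nbhd by blast
    ultimately show ?thesis using D(3) by blast
  qed
  then have "\<forall>h\<in>H. \<forall>R\<in>Fpow \<Omega>. D \<inter> nbhd R h \<noteq> {}" by blast
  then show thesis using D(1,2) that by blast
qed

abbreviation Fix :: "'a set \<Rightarrow> ('a \<Rightarrow> 'a) set" where
  "Fix R \<equiv> nbhd R (\<lambda>v. v)"

lemma in_Fix_iff: "f \<in> Fix R \<longleftrightarrow> f \<in> A \<and> (\<forall>r\<in>R. f r = r)"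
  by (simp add: nbhd_def)

lemma Fix_in_A: "f \<in> Fix R \<Longrightarrow> f \<in> A"
  by (simp add: in_Fix_iff)

lemma Fix_antimono: "R \<subseteq> R' \<Longrightarrow> Fix R' \<subseteq> Fix R"
  by (simp add: nbhd_def subset_iff)

lemma Fpow_subset: "R \<in> Fpow \<Omega> \<Longrightarrow> R \<subseteq> \<Omega>"
  by (simp add: Fpow_def)

lemma subgroup_Fix:
  assumes "R \<subseteq> \<Omega>"
  shows "subgroup (Fix R) G"
proof (rule subgroupI)
  show "Fix R \<subseteq> carrier G" using nbhd_subset by simp
  have "\<one> \<in> Fix R" using assms by (auto simp: in_Fix_iff one_apply)
  then show "Fix R \<noteq> {}" by blast
  show "inv f \<in> Fix R" if "f \<in> Fix R" for f
  proof -
    have "(inv f) r = r" if "r \<in> R" for r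
      using \<open>f \<in> Fix R\<close> that assms inv_apply[of f r] by (auto simp: in_Fix_iff)
    then show ?thesis using that by (simp add: in_Fix_iff)
  qed
  show "f \<otimes> g \<in> Fix R" if "f \<in> Fix R" "g \<in> Fix R" for f g
    using that assms by (auto simp: in_Fix_iff mult_apply subset_iff)
qed

lemma Fix_coset_iff:
  assumes R: "R \<subseteq> \<Omega>" and g: "g \<in> A"
  shows "g' \<in> Fix R #> g \<longleftrightarrow> g' \<in> A \<and> (\<forall>v\<in>\<Omega>. g v \<in> R \<longrightarrow> g' v = g v)"
proof
  assume "g' \<in> Fix R #> g"
  then obtain f where "f \<in> Fix R" "g' = f \<otimes> g" by (auto simp: r_coset_def)
  then show "g' \<in> A \<and> (\<forall>v\<in>\<Omega>. g v \<in> R \<longrightarrow> g' v = g v)"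
    using g by (auto simp: in_Fix_iff mult_apply)
next
  assume g': "g' \<in> A \<and> (\<forall>v\<in>\<Omega>. g v \<in> R \<longrightarrow> g' v = g v)"
  have "(g' \<otimes> inv g) r = r" if "r \<in> R" for r
  proof -
    have r: "r \<in> \<Omega>" "(inv g) r \<in> \<Omega>" using that R g A_closed by auto
    then show ?thesis using g g' that by (simp add: mult_apply apply_inv)
  qed
  then have "g' \<otimes> inv g \<in> Fix R" using g g' by (simp add: in_Fix_iff)
  then show "g' \<in> Fix R #> g"
    using subgroup.rcos_module[OF subgroup_Fix[OF R] is_group, of g g'] g g' by simp
qed

lemma eventually_constant_limit_in_A:
  assumes g: "\<And>s. g s \<in> A" and l: "l \<in> extensional \<Omega>" "\<Omega> \<subseteq> l ` \<Omega>"
    and limit: "\<And>v. v \<in> \<Omega> \<Longrightarrow> \<forall>\<^sub>F s in sequentially. g s v = l v"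
  shows "l \<in> A"
proof -
  have close: "nbhd R l \<noteq> {}" if "R \<in> Fpow \<Omega>" for R
  proof -
    have "\<forall>\<^sub>F s in sequentially. \<forall>v\<in>R. g s v = l v"
      using that limit by (intro eventually_ball_finite) (auto simp: Fpow_def)
    then obtain s where "\<forall>v\<in>R. g s v = l v" unfolding eventually_sequentially by blast
    then have "g s \<in> nbhd R l" using g by (simp add: nbhd_def)
    then show ?thesis by blast
  qed
  have "l v \<in> \<Omega>" if v: "v \<in> \<Omega>" for v
  proof -
    obtain s where "g s v = l v" using limit[OF v] unfolding eventually_sequentially by blast
    then show ?thesis using A_closed[OF g v] by metis
  qed
  then have "l \<in> \<Omega> \<rightarrow>\<^sub>E \<Omega>" using l(1) by (simp add: PiE_def)
  then show ?thesis using close l(2) by (subst in_A_iff) blast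
qed

lemma Fix_coset_sequence_stable:
  assumes g: "\<And>s. g s \<in> A" and R: "\<And>s. R s \<subseteq> \<Omega>" "\<And>s. R s \<subseteq> R (Suc s)"
    and coset: "\<And>s. g (Suc s) \<in> Fix (R s) #> g s"
    and v: "v \<in> \<Omega>" "g s v \<in> R s" and "s \<le> t"
  shows "g t v = g s v \<and> g t v \<in> R t"
  using \<open>s \<le> t\<close>
proof (induction t rule: dec_induct)
  case base
  then show ?case using v by simp
next
  case (step t)
  then have "g (Suc t) v = g t v"
    using Fix_coset_iff[OF R(1) g] coset v(1) by blast
  then show ?case using step.IH R(2)[of t] by auto
qed

lemma Fix_coset_sequence_limit:
  assumes g: "\<And>s. g s \<in> A" and R: "\<And>s. R s \<subseteq> \<Omega>" "\<And>s. R s \<subseteq> R (Suc s)"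
    and step: "\<And>s. g (Suc s) \<in> Fix (R s) #> g s"
    and dom: "\<And>v. v \<in> \<Omega> \<Longrightarrow> \<exists>s. g s v \<in> R s" and ran: "\<And>u. u \<in> \<Omega> \<Longrightarrow> \<exists>s. u \<in> R s"
  shows "\<exists>l. \<forall>s. l \<in> Fix (R s) #> g s"
proof -
  note stable = Fix_coset_sequence_stable[of g R, OF g R step]
  obtain \<sigma> where \<sigma>: "\<And>v. v \<in> \<Omega> \<Longrightarrow> g (\<sigma> v) v \<in> R (\<sigma> v)"
    using dom by metis
  define l where "l = (\<lambda>v\<in>\<Omega>. g (\<sigma> v) v)"
  have l_eq: "l v = g s v" if "v \<in> \<Omega>" "g s v \<in> R s" for s v
    using stable[of v s "max s (\<sigma> v)"] stable[of v "\<sigma> v" "max s (\<sigma> v)"] \<sigma>[of v] that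
    by (simp add: l_def)
  have "l \<in> A"
  proof (rule eventually_constant_limit_in_A[OF g])
    show "l \<in> extensional \<Omega>" by (simp add: l_def)
    show "\<Omega> \<subseteq> l ` \<Omega>"
    proof
      fix u assume u: "u \<in> \<Omega>"
      then obtain s where s: "u \<in> R s" using ran by blast
      have "(inv (g s)) u \<in> \<Omega>" "g s ((inv (g s)) u) = u"
        using A_closed[OF inv_A[OF g]] apply_inv[OF g] u by auto
      then show "u \<in> l ` \<Omega>" using l_eq s by (metis imageI)
    qed
    show "\<forall>\<^sub>F s in sequentially. g s v = l v" if v: "v \<in> \<Omega>" for v
    proof -
      have "g s v = l v" if "\<sigma> v \<le> s" for s
        using stable[OF v \<sigma>[OF v] that] v by (simp add: l_def)
      then show ?thesis unfolding eventually_sequentially by blast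
    qed
  qed
  then have "l \<in> Fix (R s) #> g s" for s
    using Fix_coset_iff[OF R(1) g] l_eq by blast
  then show ?thesis by blast
qed

subsection \<open>Decoding a relation into a permutation\<close>

definition is_graph_of :: "('a \<Rightarrow> 'a \<Rightarrow> bool) \<Rightarrow> ('a \<Rightarrow> 'a) \<Rightarrow> bool" where
  "is_graph_of P f \<longleftrightarrow> f \<in> A \<and> (\<forall>u\<in>\<Omega>. \<forall>v\<in>\<Omega>. P u v \<longleftrightarrow> f v = u)"

definition element_of :: "('a \<Rightarrow> 'a \<Rightarrow> bool) \<Rightarrow> 'a \<Rightarrow> 'a" where
  "element_of P = (if \<exists>f. is_graph_of P f then THE f. is_graph_of P f else \<one>)"

lemma is_graph_ofD: "is_graph_of P f \<Longrightarrow> u \<in> \<Omega> \<Longrightarrow> v \<in> \<Omega> \<Longrightarrow> P u v \<longleftrightarrow> f v = u"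
  by (simp add: is_graph_of_def)

lemma is_graph_of_unique:
  assumes "is_graph_of P f" "is_graph_of P f'"
  shows "f = f'"
proof (rule A_ext)
  show f: "f \<in> A" and "f' \<in> A" using assms by (simp_all add: is_graph_of_def)
  fix v assume v: "v \<in> \<Omega>"
  show "f v = f' v"
    using is_graph_ofD[OF assms(1) A_closed[OF f v] v] is_graph_ofD[OF assms(2) A_closed[OF f v] v]
    by simp
qed

lemma element_of_eq:
  assumes "is_graph_of P f"
  shows "element_of P = f"
proof -
  have "(THE f. is_graph_of P f) = f"
    using assms is_graph_of_unique by (intro the_equality)
  then show ?thesis using assms by (auto simp: element_of_def)
qed

lemma element_of_in_A: "element_of P \<in> A"
proof (cases "\<exists>f. is_graph_of P f")
  case True
  then show ?thesis using element_of_eq is_graph_of_def by metis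
qed (simp add: element_of_def)

lemma is_graph_of_imp:
  assumes graph: "is_graph_of P f"
    and dense: "\<forall>h\<in>A. \<forall>R\<in>Fpow \<Omega>. D \<inter> nbhd R h \<noteq> {}"
  shows "\<forall>u\<in>\<Omega>. \<exists>v\<in>\<Omega>. P u v"
    and "\<forall>u\<in>\<Omega>. \<forall>u'\<in>\<Omega>. \<forall>v\<in>\<Omega>. P u v \<longrightarrow> P u' v \<longrightarrow> u = u'"
    and "\<forall>R\<in>Fpow \<Omega>. \<exists>g\<in>D. \<forall>v\<in>R. P (g v) v"
proof -
  note P_iff = is_graph_ofD[OF graph]
  have f: "f \<in> A" using graph by (simp add: is_graph_of_def)
  show "\<forall>u\<in>\<Omega>. \<exists>v\<in>\<Omega>. P u v"
  proof
    fix u assume u: "u \<in> \<Omega>"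
    then have "(inv f) u \<in> \<Omega>" "f ((inv f) u) = u"
      using f A_closed[OF inv_A] apply_inv by auto
    then show "\<exists>v\<in>\<Omega>. P u v" using P_iff[OF u] by blast
  qed
  show "\<forall>u\<in>\<Omega>. \<forall>u'\<in>\<Omega>. \<forall>v\<in>\<Omega>. P u v \<longrightarrow> P u' v \<longrightarrow> u = u'"
    using P_iff by simp
  show "\<forall>R\<in>Fpow \<Omega>. \<exists>g\<in>D. \<forall>v\<in>R. P (g v) v"
  proof
    fix R assume R: "R \<in> Fpow \<Omega>"
    then obtain g where g: "g \<in> D" "g \<in> nbhd R f" using dense f by blast
    have "P (g v) v" if v: "v \<in> R" for v
    proof -
      have "v \<in> \<Omega>" using R v Fpow_subset by blast
      moreover have "g v = f v" using g(2) v by (simp add: nbhd_def)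
      ultimately show ?thesis using P_iff f A_closed by simp
    qed
    then show "\<exists>g\<in>D. \<forall>v\<in>R. P (g v) v" using g(1) by blast
  qed
qed

lemma ex_is_graph_ofI:
  assumes D: "D \<subseteq> A"
    and surj: "\<forall>u\<in>\<Omega>. \<exists>v\<in>\<Omega>. P u v"
    and functional: "\<forall>u\<in>\<Omega>. \<forall>u'\<in>\<Omega>. \<forall>v\<in>\<Omega>. P u v \<longrightarrow> P u' v \<longrightarrow> u = u'"
    and approx: "\<forall>R\<in>Fpow \<Omega>. \<exists>g\<in>D. \<forall>v\<in>R. P (g v) v"
  shows "\<exists>f. is_graph_of P f"
proof -
  have "\<exists>u\<in>\<Omega>. P u v" if "v \<in> \<Omega>" for v
  proof -
    have "{v} \<in> Fpow \<Omega>" using that by (simp add: Fpow_def)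
    from bspec[OF approx this] obtain g where g: "g \<in> D" "P (g v) v" by blast
    then have "g v \<in> \<Omega>" using D A_closed that by blast
    then show ?thesis using g(2) by (rule rev_bexI)
  qed
  then obtain f' where f': "\<And>v. v \<in> \<Omega> \<Longrightarrow> f' v \<in> \<Omega> \<and> P (f' v) v" by metis
  define f where "f = restrict f' \<Omega>"
  have P_iff: "P u v \<longleftrightarrow> f v = u" if "u \<in> \<Omega>" "v \<in> \<Omega>" for u v
  proof -
    have "f v \<in> \<Omega>" "P (f v) v" using f'[OF that(2)] that(2) by (simp_all add: f_def)
    then show ?thesis using functional that by blast
  qed
  have "nbhd R f \<noteq> {}" if R: "R \<in> Fpow \<Omega>" for R
  proof -
    from bspec[OF approx R] obtain g where g: "g \<in> D" "\<forall>v\<in>R. P (g v) v" by blast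
    have "g v = f v" if v: "v \<in> R" for v
    proof -
      have "v \<in> \<Omega>" using R v Fpow_subset by blast
      moreover from this have "g v \<in> \<Omega>" using g(1) D A_closed by blast
      ultimately show ?thesis using P_iff[of "g v" v] g(2) v by metis
    qed
    then have "g \<in> nbhd R f" using g(1) D unfolding nbhd_def by blast
    then show ?thesis by blast
  qed
  moreover have "\<Omega> \<subseteq> f ` \<Omega>"
  proof
    fix u assume u: "u \<in> \<Omega>"
    then obtain v where "v \<in> \<Omega>" "P u v" using surj by blast
    then show "u \<in> f ` \<Omega>" using P_iff[OF u] by blast
  qed
  moreover have "f \<in> \<Omega> \<rightarrow>\<^sub>E \<Omega>" using f' by (auto simp: f_def)
  ultimately have "f \<in> A" by (subst in_A_iff) blast
  then show ?thesis using P_iff unfolding is_graph_of_def by blast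
qed

lemma ex_is_graph_of_iff:
  assumes D: "D \<subseteq> A" "\<forall>h\<in>A. \<forall>R\<in>Fpow \<Omega>. D \<inter> nbhd R h \<noteq> {}"
  shows "(\<exists>f. is_graph_of P f) \<longleftrightarrow>
    (\<forall>u\<in>\<Omega>. \<exists>v\<in>\<Omega>. P u v) \<and>
    (\<forall>u\<in>\<Omega>. \<forall>u'\<in>\<Omega>. \<forall>v\<in>\<Omega>. P u v \<longrightarrow> P u' v \<longrightarrow> u = u') \<and>
    (\<forall>R\<in>Fpow \<Omega>. \<exists>g\<in>D. \<forall>v\<in>R. P (g v) v)"
    (is "_ \<longleftrightarrow> ?surj \<and> ?functional \<and> ?approx")
proof
  assume "\<exists>f. is_graph_of P f"
  then obtain f where "is_graph_of P f" by blast
  then show "?surj \<and> ?functional \<and> ?approx" using D(2) by (intro conjI is_graph_of_imp)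
next
  assume "?surj \<and> ?functional \<and> ?approx"
  then show "\<exists>f. is_graph_of P f" by (elim conjE) (rule ex_is_graph_ofI[OF D(1)])
qed

lemma measurable_borel_of_T:
  assumes e: "\<And>y. y \<in> space N \<Longrightarrow> e y \<in> A"
    and pred: "\<And>u v. u \<in> \<Omega> \<Longrightarrow> v \<in> \<Omega> \<Longrightarrow> Measurable.pred N (\<lambda>y. e y v = u)"
  shows "e \<in> N \<rightarrow>\<^sub>M borel_of T"
proof (rule measurable_borel_of_countable_base[OF countable_base_cylinders])
  fix V assume "V \<in> (\<lambda>(c, a). cylinder c a) ` (lists \<Omega> \<times> lists \<Omega>)"
  then obtain c a where V: "V = cylinder c a" and ca: "c \<in> lists \<Omega>" "a \<in> lists \<Omega>" by auto
  have "Measurable.pred N (\<lambda>y. map (e y) c = a)"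
    using ca
  proof (induction c arbitrary: a)
    case (Cons v c)
    then show ?case using pred by (cases a) auto
  qed auto
  moreover have "e -` V \<inter> space N = {y \<in> space N. map (e y) c = a}"
    using e by (auto simp: V cylinder_def)
  ultimately show "e -` V \<inter> space N \<in> sets N" by (simp add: pred_def)
qed (use e in simp)

lemma measurable_element_of:
  assumes P: "\<And>u v. u \<in> \<Omega> \<Longrightarrow> v \<in> \<Omega> \<Longrightarrow> Measurable.pred N (\<lambda>y. P y u v)"
  shows "(\<lambda>y. element_of (P y)) \<in> N \<rightarrow>\<^sub>M borel_of T"
proof (rule measurable_borel_of_T)
  obtain D where D: "countable D" "D \<subseteq> A" "\<forall>h\<in>A. \<forall>R\<in>Fpow \<Omega>. D \<inter> nbhd R h \<noteq> {}"
    by (rule countable_dense_subset[OF order_refl]) blast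
  have "Measurable.pred N (\<lambda>y. P y (g v) v)" if "g \<in> D" "v \<in> \<Omega>" for g v
    using that D(2) A_closed by (intro P) auto
  then have graph: "Measurable.pred N (\<lambda>y. \<exists>f. is_graph_of (P y) f)"
    unfolding ex_is_graph_of_iff[OF D(2,3)]
    by (intro pred_intros_logic pred_countable_Bex pred_countable_Ball
        D(1) countable_\<Omega> countable_Fpow_\<Omega>) (use P in \<open>auto simp: Fpow_def intro: countable_finite\<close>)
  fix u v assume uv: "u \<in> \<Omega>" "v \<in> \<Omega>"
  have "element_of (P y) v = u \<longleftrightarrow>
      (if \<exists>f. is_graph_of (P y) f then P y u v else \<one> v = u)" for y
  proof (cases "\<exists>f. is_graph_of (P y) f")
    case True
    then obtain f where f: "is_graph_of (P y) f" by blast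
    then show ?thesis using True is_graph_ofD[OF f uv] by (simp add: element_of_eq)
  qed (simp add: element_of_def)
  then show "Measurable.pred N (\<lambda>y. element_of (P y) v = u)"
    using graph P[OF uv] by simp
qed (rule element_of_in_A)

end

section \<open>Coding group elements by points of an orbit\<close>

text \<open>Equivalently, for every \<open>n\<close> there are only finitely many orbits of \<open>n\<close>-tuples.\<close>

definition (in closed_perm_group) oligomorphic :: bool where
  "oligomorphic \<longleftrightarrow> (\<forall>R\<in>Fpow \<Omega>. \<exists>S\<in>Fpow \<Omega>. \<forall>v\<in>\<Omega>. \<exists>f\<in>Fix R. f v \<in> S)"

text \<open>Each point \<open>y\<close> carries a structure with universe \<open>\<Omega>\<close>, in which \<open>sat s\<close> interprets \<open>s\<close>.\<close>

locale equivariant_coding =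
  closed_perm_group \<Omega> A G T + group_action G "space N" \<phi>
  for \<Omega> :: "'a set" and A and G (structure) and T and N :: "'x measure" and \<phi> +
  fixes S :: "'s set" and sat :: "'s \<Rightarrow> 'a list \<Rightarrow> 'x \<Rightarrow> bool"
  assumes oligomorphic: oligomorphic
    and countable_S: "countable S"
    and S_nonempty: "S \<noteq> {}"
    and sat_action: "\<And>s c g y. s \<in> S \<Longrightarrow> c \<in> lists \<Omega> \<Longrightarrow> g \<in> A \<Longrightarrow> y \<in> space N \<Longrightarrow>
      sat s (map g c) (\<phi> g y) \<longleftrightarrow> sat s c y"
    and sat_separates: "\<And>y y'. y \<in> space N \<Longrightarrow> y' \<in> space N \<Longrightarrow>
      (\<And>s c. s \<in> S \<Longrightarrow> c \<in> lists \<Omega> \<Longrightarrow> sat s c y \<longleftrightarrow> sat s c y') \<Longrightarrow> y = y'"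
    and pred_sat: "\<And>s c. s \<in> S \<Longrightarrow> c \<in> lists \<Omega> \<Longrightarrow> Measurable.pred N (sat s c)"
begin

lemma action_closed_A: "g \<in> A \<Longrightarrow> y \<in> space N \<Longrightarrow> \<phi> g y \<in> space N"
  using action_closed by simp

lemma action_mult_A: "f \<in> A \<Longrightarrow> g \<in> A \<Longrightarrow> y \<in> space N \<Longrightarrow> \<phi> (f \<otimes> g) y = \<phi> f (\<phi> g y)"
  using composition_rule by simp

definition atom :: "nat \<Rightarrow> 's \<times> 'a list" where
  "atom = from_nat_into (S \<times> lists \<Omega>)"

definition params :: "nat \<Rightarrow> 'a set" where
  "params n = set (snd (atom n))"

definition holds :: "nat \<Rightarrow> 'x \<Rightarrow> bool" where
  "holds n = sat (fst (atom n)) (snd (atom n))"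

lemma atom_in: "fst (atom n) \<in> S" "snd (atom n) \<in> lists \<Omega>"
proof -
  have "atom n \<in> S \<times> lists \<Omega>"
    unfolding atom_def using S_nonempty by (intro from_nat_into) auto
  then show "fst (atom n) \<in> S" "snd (atom n) \<in> lists \<Omega>" by auto
qed

lemma params_Fpow: "params n \<in> Fpow \<Omega>"
  using atom_in(2)[of n] by (auto simp: params_def Fpow_def)

lemma pred_holds: "Measurable.pred N (holds n)"
  unfolding holds_def by (intro pred_sat atom_in)

lemma holds_Fix:
  assumes "y \<in> space N" and f: "f \<in> Fix (params n)"
  shows "holds n (\<phi> f y) \<longleftrightarrow> holds n y"
proof -
  have "map f (snd (atom n)) = snd (atom n)"
    using f by (intro map_idI) (simp add: in_Fix_iff params_def)
  then show ?thesis
    using sat_action[OF atom_in(1) atom_in(2) Fix_in_A[OF f] assms(1), of n n]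
    by (simp add: holds_def)
qed

lemma holds_separates:
  assumes "y \<in> space N" "y' \<in> space N" "\<And>n. holds n y \<longleftrightarrow> holds n y'"
  shows "y = y'"
proof (rule sat_separates[OF assms(1,2)])
  fix s c assume "s \<in> S" "c \<in> lists \<Omega>"
  then obtain n where "atom n = (s, c)"
    unfolding atom_def using countable_S countable_\<Omega>
    by (metis SigmaI countable_SIGMA countable_lists from_nat_into_surj)
  then show "sat s c y \<longleftrightarrow> sat s c y'" using assms(3)[of n] by (simp add: holds_def)
qed

definition varies :: "'a set \<Rightarrow> nat \<Rightarrow> 'x \<Rightarrow> bool" where
  "varies R n y \<longleftrightarrow> (\<exists>f\<in>Fix R. holds n (\<phi> f y)) \<and> (\<exists>f\<in>Fix R. \<not> holds n (\<phi> f y))"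

text \<open>An arbitrary number if nothing varies, which can happen only for finitely supported \<open>y\<close>.\<close>

definition site :: "'a set \<Rightarrow> 'x \<Rightarrow> nat" where
  "site R y = (LEAST n. varies R n y)"

definition reps :: "'a set \<Rightarrow> 'a set" where
  "reps R = (SOME S. S \<in> Fpow \<Omega> \<and> (\<forall>v\<in>\<Omega>. \<exists>f\<in>Fix R. f v \<in> S))"

definition task :: "nat \<Rightarrow> bool \<times> 'a \<times> 'a" where
  "task = from_nat_into (UNIV \<times> \<Omega> \<times> \<Omega>)"

text \<open>The intersection with \<open>\<Omega>\<close> matters only if \<open>\<Omega>\<close> is empty, when \<open>task\<close> has junk values.\<close>

definition grow :: "nat \<Rightarrow> 'a set \<Rightarrow> 'a set" where
  "grow s R = R \<union> reps R \<union> ({fst (snd (task s))} \<inter> \<Omega>)"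

primrec stage :: "nat \<Rightarrow> 'x \<Rightarrow> 'a set" where
  "stage 0 y = {}"
| "stage (Suc s) y = grow s (stage s y) \<union> params (site (grow s (stage s y)) y)"

definition code_bit :: "nat \<Rightarrow> 'x \<Rightarrow> bool" where
  "code_bit s y \<longleftrightarrow> holds (site (grow s (stage s y)) y) y"

lemma
  assumes "R \<in> Fpow \<Omega>"
  shows reps_Fpow: "reps R \<in> Fpow \<Omega>"
    and reps_meet_orbits: "\<And>v. v \<in> \<Omega> \<Longrightarrow> \<exists>f\<in>Fix R. f v \<in> reps R"
proof -
  have "\<exists>S. S \<in> Fpow \<Omega> \<and> (\<forall>v\<in>\<Omega>. \<exists>f\<in>Fix R. f v \<in> S)"
    using oligomorphic assms unfolding oligomorphic_def by blast
  then have "reps R \<in> Fpow \<Omega> \<and> (\<forall>v\<in>\<Omega>. \<exists>f\<in>Fix R. f v \<in> reps R)"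
    unfolding reps_def by (rule someI_ex)
  then show "reps R \<in> Fpow \<Omega>" "\<And>v. v \<in> \<Omega> \<Longrightarrow> \<exists>f\<in>Fix R. f v \<in> reps R" by simp_all
qed

lemma task_surj: "u \<in> \<Omega> \<Longrightarrow> v \<in> \<Omega> \<Longrightarrow> \<exists>s. task s = (i, u, v)"
  unfolding task_def using countable_\<Omega>
  by (intro from_nat_into_surj countable_SIGMA) auto

lemma grow_Fpow:
  assumes "R \<in> Fpow \<Omega>"
  shows "grow s R \<in> Fpow \<Omega>"
  using assms reps_Fpow[OF assms] by (auto simp: grow_def Fpow_def)

lemma stage_Fpow: "stage s y \<in> Fpow \<Omega>"
proof (induction s)
  case (Suc s)
  then show ?case
    using grow_Fpow[OF Suc, of s] params_Fpow by (auto simp: Fpow_def)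
qed (simp add: Fpow_def)

lemma stage_subset: "stage s y \<subseteq> \<Omega>"
  using stage_Fpow Fpow_subset by blast

lemma subset_grow: "R \<subseteq> grow s R"
  by (auto simp: grow_def)

lemma grow_subset_stage: "grow s (stage s y) \<subseteq> stage (Suc s) y"
  by auto

lemma Fix_orbit_eq:
  assumes y: "y \<in> space N" and R: "R \<subseteq> \<Omega>" and g: "g \<in> Fix R"
  shows "(\<lambda>f. \<phi> f (\<phi> g y)) ` Fix R = (\<lambda>f. \<phi> f y) ` Fix R"
proof -
  have "(\<lambda>f. \<phi> f (\<phi> g y)) ` Fix R = (\<lambda>f. \<phi> f y) ` (Fix R #> g)"
    using y g by (auto simp: r_coset_def action_mult_A Fix_in_A image_iff)
  then show ?thesis
    using subgroup.rcos_const[OF subgroup_Fix[OF R] is_group g] by simp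
qed

lemma site_Fix:
  assumes "y \<in> space N" "R \<subseteq> \<Omega>" "g \<in> Fix R"
  shows "site R (\<phi> g y) = site R y"
proof -
  have varies_iff: "varies R n z \<longleftrightarrow>
      (\<exists>w\<in>(\<lambda>f. \<phi> f z) ` Fix R. holds n w) \<and> (\<exists>w\<in>(\<lambda>f. \<phi> f z) ` Fix R. \<not> holds n w)" for n z
    by (simp add: varies_def)
  show ?thesis by (simp only: site_def varies_iff Fix_orbit_eq[OF assms])
qed

lemma stage_Fix:
  assumes "y \<in> space N" "f \<in> Fix (stage s y)"
  shows "stage s (\<phi> f y) = stage s y"
  using assms(2)
proof (induction s)
  case (Suc s)
  have f: "f \<in> Fix (grow s (stage s y))"
    using Suc.prems Fix_antimono[OF grow_subset_stage] by blast
  then have "stage s (\<phi> f y) = stage s y"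
    using Suc.IH Fix_antimono[OF subset_grow] by blast
  moreover have "site (grow s (stage s y)) (\<phi> f y) = site (grow s (stage s y)) y"
    by (intro site_Fix assms(1) f Fpow_subset grow_Fpow stage_Fpow)
  ultimately show ?case by simp
qed simp

lemma site_grow_stage_Fix:
  assumes "y \<in> space N" "f \<in> Fix (grow s (stage s y))"
  shows "site (grow s (stage s (\<phi> f y))) (\<phi> f y) = site (grow s (stage s y)) y"
  using assms stage_Fix[OF assms(1), of f s] Fix_antimono[OF subset_grow]
    site_Fix[OF assms(1) Fpow_subset[OF grow_Fpow[OF stage_Fpow]] assms(2)]
  by fastforce

lemma code_bit_Fix:
  assumes y: "y \<in> space N" and f: "f \<in> Fix (stage (Suc s) y)"
  shows "code_bit s (\<phi> f y) \<longleftrightarrow> code_bit s y"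
proof -
  have "f \<in> Fix (grow s (stage s y))"
    using f Fix_antimono[OF grow_subset_stage] by blast
  moreover have "f \<in> Fix (params (site (grow s (stage s y)) y))"
    using f by (simp add: in_Fix_iff)
  ultimately show ?thesis
    unfolding code_bit_def by (simp add: site_grow_stage_Fix[OF y] holds_Fix[OF y])
qed

lemma Fix_coset_action:
  assumes "x \<in> space N" "g \<in> A" "g' \<in> Fix R #> g"
  obtains f where "f \<in> Fix R" "\<phi> g' x = \<phi> f (\<phi> g x)"
  using assms Fix_in_A by (auto simp: r_coset_def action_mult_A)

lemma stage_coset:
  assumes "x \<in> space N" "g \<in> A" "g' \<in> Fix (stage s (\<phi> g x)) #> g"
  shows "stage s (\<phi> g' x) = stage s (\<phi> g x)"
  by (rule Fix_coset_action[OF assms]) (simp add: stage_Fix action_closed_A assms)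

lemma code_bit_coset:
  assumes "x \<in> space N" "g \<in> A" "g' \<in> Fix (stage (Suc s) (\<phi> g x)) #> g"
  shows "code_bit s (\<phi> g' x) \<longleftrightarrow> code_bit s (\<phi> g x)"
  by (rule Fix_coset_action[OF assms])
    (simp add: code_bit_Fix action_closed_A assms del: stage.simps)

definition finitely_supported :: "'x \<Rightarrow> bool" where
  "finitely_supported y \<longleftrightarrow> (\<exists>R\<in>Fpow \<Omega>. Fix R \<subseteq> stabilizer G \<phi> y)"

lemma finitely_supported_action:
  assumes x: "x \<in> space N" and g: "g \<in> A" and gx: "finitely_supported (\<phi> g x)"
  shows "finitely_supported x"
proof -
  obtain R where R: "R \<in> Fpow \<Omega>" "Fix R \<subseteq> stabilizer G \<phi> (\<phi> g x)"
    using gx unfolding finitely_supported_def by blast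
  have "f \<in> stabilizer G \<phi> x" if f: "f \<in> Fix ((inv g) ` R)" for f
  proof -
    have fA: "f \<in> A" by (rule Fix_in_A[OF f])
    have "(g \<otimes> f \<otimes> inv g) r = r" if r: "r \<in> R" for r
    proof -
      have r': "r \<in> \<Omega>" using R(1) r Fpow_subset by blast
      have "f ((inv g) r) = (inv g) r" using f r by (simp add: in_Fix_iff)
      then show ?thesis
        using fA g r' A_closed[OF inv_A[OF g] r'] by (simp add: mult_apply apply_inv)
    qed
    then have "g \<otimes> f \<otimes> inv g \<in> Fix R" using fA g by (simp add: in_Fix_iff)
    then have "\<phi> (g \<otimes> f \<otimes> inv g) (\<phi> g x) = \<phi> g x"
      using R(2) by (auto simp: stabilizer_def)
    then have "\<phi> g (\<phi> f x) = \<phi> g x"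
      using fA g x by (simp add: action_mult_A action_closed_A action_inv)
    then have "\<phi> f x = x"
      using action_inv[of g] g fA x action_closed_A by (metis carrier_G)
    then show ?thesis using fA by (simp add: stabilizer_def)
  qed
  moreover have "(inv g) ` R \<in> Fpow \<Omega>"
    using R(1) A_closed[OF inv_A[OF g]] by (auto simp: Fpow_def)
  ultimately show ?thesis unfolding finitely_supported_def by blast
qed

lemma varies_site:
  assumes y: "y \<in> space N" and unsupported: "\<not> finitely_supported y" and R: "R \<in> Fpow \<Omega>"
  shows "varies R (site R y) y"
proof -
  obtain f where f: "f \<in> Fix R" "\<phi> f y \<noteq> y"
    using unsupported R Fix_in_A unfolding finitely_supported_def stabilizer_def by fastforce
  obtain n where n: "holds n (\<phi> f y) \<noteq> holds n y"
    using holds_separates[OF action_closed_A[OF Fix_in_A[OF f(1)] y] y] f(2) by blast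
  have "\<one> \<in> Fix R" by (rule subgroup.one_closed[OF subgroup_Fix[OF Fpow_subset[OF R]]])
  then have "varies R n y"
    using f(1) n action_one[OF y] unfolding varies_def by metis
  then show ?thesis unfolding site_def by (rule LeastI)
qed

lemma set_code_bit:
  assumes y: "y \<in> space N" and unsupported: "\<not> finitely_supported y"
  shows "\<exists>f\<in>Fix (grow s (stage s y)). code_bit s (\<phi> f y) \<longleftrightarrow> b"
proof -
  have "varies (grow s (stage s y)) (site (grow s (stage s y)) y) y"
    by (intro varies_site y unsupported grow_Fpow stage_Fpow)
  then obtain f where f: "f \<in> Fix (grow s (stage s y))"
      "holds (site (grow s (stage s y)) y) (\<phi> f y) \<longleftrightarrow> b"
    unfolding varies_def by (cases b) auto
  then have "code_bit s (\<phi> f y) \<longleftrightarrow> b"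
    unfolding code_bit_def by (simp add: site_grow_stage_Fix[OF y])
  then show ?thesis using f(1) by blast
qed

definition admissible :: "(nat \<Rightarrow> ('a \<Rightarrow> 'a) \<Rightarrow> bool) \<Rightarrow> bool" where
  "admissible msg \<longleftrightarrow>
     (\<forall>s R. \<forall>f\<in>Fix (grow s R). \<forall>h\<in>A. msg s (f \<otimes> h) \<longleftrightarrow> msg s h)"

lemma admissibleD:
  "admissible msg \<Longrightarrow> f \<in> Fix (grow s R) \<Longrightarrow> h \<in> A \<Longrightarrow> msg s (f \<otimes> h) \<longleftrightarrow> msg s h"
  by (simp add: admissible_def)

lemma coding_step:
  assumes x: "x \<in> space N" and unsupported: "\<not> finitely_supported x" and g: "g \<in> A" and v: "v \<in> \<Omega>"
    and msg: "admissible msg"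
  shows "\<exists>g'. g' \<in> Fix (stage s (\<phi> g x)) #> g \<and> g' v \<in> stage (Suc s) (\<phi> g' x) \<and>
    (code_bit s (\<phi> g' x) \<longleftrightarrow> msg s g')"
proof -
  let ?R = "stage s (\<phi> g x)"
  obtain f where f: "f \<in> Fix ?R" "f (g v) \<in> reps ?R"
    using reps_meet_orbits[OF stage_Fpow A_closed[OF g v]] by blast
  define h where "h = f \<otimes> g"
  have h: "h \<in> A" using f g Fix_in_A by (simp add: h_def)
  have "h \<in> Fix ?R #> g" using f(1) unfolding h_def r_coset_def by blast
  from stage_coset[OF x g this] have stage_h: "stage s (\<phi> h x) = ?R" .
  have "\<not> finitely_supported (\<phi> h x)"
    using unsupported finitely_supported_action[OF x h] by blast
  from set_code_bit[OF action_closed_A[OF h x] this, of s "msg s h"] stage_h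
  obtain k where k: "k \<in> Fix (grow s ?R)" "code_bit s (\<phi> k (\<phi> h x)) \<longleftrightarrow> msg s h"
    by auto
  have kA: "k \<in> A" by (rule Fix_in_A[OF k(1)])
  have "k \<in> Fix ?R" using k(1) Fix_antimono[OF subset_grow] by blast
  then have "k \<otimes> f \<in> Fix ?R"
    using f(1) by (rule subgroup.m_closed[OF subgroup_Fix[OF stage_subset]])
  moreover have "k \<otimes> h = (k \<otimes> f) \<otimes> g"
    using f(1) g kA Fix_in_A by (simp add: h_def m_assoc)
  ultimately have coset: "k \<otimes> h \<in> Fix ?R #> g" unfolding r_coset_def by blast
  moreover have "(k \<otimes> h) v \<in> stage (Suc s) (\<phi> (k \<otimes> h) x)"
  proof -
    have "h v \<in> grow s ?R" using f g v Fix_in_A by (simp add: h_def mult_apply grow_def)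
    moreover from this have "(k \<otimes> h) v = h v"
      using k(1) kA h v by (simp add: mult_apply in_Fix_iff)
    ultimately show ?thesis using stage_coset[OF x g coset] by simp
  qed
  moreover have "code_bit s (\<phi> (k \<otimes> h) x) \<longleftrightarrow> msg s (k \<otimes> h)"
    using k(2) admissibleD[OF msg k(1) h] kA h x by (simp add: action_mult_A)
  ultimately show ?thesis by blast
qed

lemma coding_sequence:
  assumes x: "x \<in> space N" and unsupported: "\<not> finitely_supported x"
    and task: "\<And>s. snd (snd (task s)) \<in> \<Omega>"
    and msg: "admissible msg"
  obtains g where "\<And>s. g s \<in> A" "\<And>s. g (Suc s) \<in> Fix (stage s (\<phi> (g s) x)) #> g s"
    "\<And>s. g (Suc s) (snd (snd (task s))) \<in> stage (Suc s) (\<phi> (g (Suc s)) x)"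
    "\<And>s. code_bit s (\<phi> (g (Suc s)) x) \<longleftrightarrow> msg s (g (Suc s))"
proof -
  have "\<exists>g. \<forall>s. g s \<in> A \<and> (g (Suc s) \<in> Fix (stage s (\<phi> (g s) x)) #> g s \<and>
      g (Suc s) (snd (snd (task s))) \<in> stage (Suc s) (\<phi> (g (Suc s)) x) \<and>
      (code_bit s (\<phi> (g (Suc s)) x) \<longleftrightarrow> msg s (g (Suc s))))"
  proof (rule dependent_nat_choice)
    show "\<exists>g. g \<in> A" using one_A by blast
    fix g s assume g: "g \<in> A"
    obtain g' where g': "g' \<in> Fix (stage s (\<phi> g x)) #> g"
        "g' (snd (snd (task s))) \<in> stage (Suc s) (\<phi> g' x)" "code_bit s (\<phi> g' x) \<longleftrightarrow> msg s g'"
      using coding_step[OF x unsupported g task msg] by blast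
    moreover have "g' \<in> A" using g'(1) Fix_coset_iff[OF stage_subset g] by blast
    ultimately show "\<exists>g'. g' \<in> A \<and> (g' \<in> Fix (stage s (\<phi> g x)) #> g \<and>
        g' (snd (snd (task s))) \<in> stage (Suc s) (\<phi> g' x) \<and> (code_bit s (\<phi> g' x) \<longleftrightarrow> msg s g'))"
      by blast
  qed
  then show thesis using that by blast
qed

lemma coding:
  assumes x: "x \<in> space N" and unsupported: "\<not> finitely_supported x"
    and task: "\<And>s. snd (snd (task s)) \<in> \<Omega>"
    and msg: "admissible msg"
  shows "\<exists>g\<in>A. \<forall>s. code_bit s (\<phi> g x) \<longleftrightarrow> msg s g"
proof -
  obtain g where g: "\<And>s. g s \<in> A"
    and step: "\<And>s. g (Suc s) \<in> Fix (stage s (\<phi> (g s) x)) #> g s"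
    and dom: "\<And>s. g (Suc s) (snd (snd (task s))) \<in> stage (Suc s) (\<phi> (g (Suc s)) x)"
    and code_bit: "\<And>s. code_bit s (\<phi> (g (Suc s)) x) \<longleftrightarrow> msg s (g (Suc s))"
    using coding_sequence[OF x unsupported task msg] by blast
  define R where "R s = stage s (\<phi> (g s) x)" for s
  have grow_R: "grow s (R s) \<subseteq> R (Suc s)" for s
    using grow_subset_stage[of s "\<phi> (g (Suc s)) x"] stage_coset[OF x g step] by (simp add: R_def)
  have "\<exists>l. \<forall>s. l \<in> Fix (R s) #> g s"
  proof (rule Fix_coset_sequence_limit[OF g])
    show "R s \<subseteq> \<Omega>" for s by (simp only: R_def stage_subset)
    show "R s \<subseteq> R (Suc s)" for s using subset_grow grow_R by blast
    show "g (Suc s) \<in> Fix (R s) #> g s" for s unfolding R_def by (rule step)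
    show "\<exists>s. g s v \<in> R s" if "v \<in> \<Omega>" for v
      using task_surj[OF that that, of True] dom unfolding R_def by (metis snd_conv)
    show "\<exists>s. u \<in> R s" if u: "u \<in> \<Omega>" for u
    proof -
      obtain s where "task s = (True, u, u)" using task_surj[OF u u] by blast
      then have "u \<in> grow s (R s)" using u by (simp add: grow_def)
      then show ?thesis using grow_R by blast
    qed
  qed
  then obtain l where l: "\<And>s. l \<in> Fix (R s) #> g s" by blast
  have "code_bit s (\<phi> l x) \<longleftrightarrow> msg s l" for s
  proof -
    have "code_bit s (\<phi> l x) \<longleftrightarrow> msg s (g (Suc s))"
      using code_bit_coset[OF x g l[of "Suc s", unfolded R_def]] code_bit by simp
    also obtain f where f: "f \<in> Fix (R (Suc s))" "l = f \<otimes> g (Suc s)"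
      using l[of "Suc s"] by (auto simp: r_coset_def)
    have "msg s (g (Suc s)) \<longleftrightarrow> msg s l"
      using admissibleD[OF msg _ g] f Fix_antimono[OF grow_R] by blast
    finally show ?thesis .
  qed
  moreover have "l \<in> A" using l[of 0] Fix_coset_iff[OF _ g, of "R 0" l 0] by (simp add: R_def)
  ultimately show ?thesis by blast
qed

definition decoded :: "bool \<Rightarrow> 'x \<Rightarrow> 'a \<Rightarrow> 'a \<Rightarrow> bool" where
  "decoded i y u v \<longleftrightarrow> (\<exists>s. task s = (i, u, v) \<and> code_bit s y)"

definition decode :: "bool \<Rightarrow> 'x \<Rightarrow> 'a \<Rightarrow> 'a" where
  "decode i y = element_of (decoded i y)"

definition message :: "(bool \<Rightarrow> 'a \<Rightarrow> 'a) \<Rightarrow> nat \<Rightarrow> ('a \<Rightarrow> 'a) \<Rightarrow> bool" where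
  "message k s g \<longleftrightarrow> (case task s of (i, u, v) \<Rightarrow> (g \<otimes> k i) v = u)"

lemma not_finitely_supported_imp_nonempty:
  assumes x: "x \<in> space N" and unsupported: "\<not> finitely_supported x"
  shows "\<Omega> \<noteq> {}"
proof
  assume "\<Omega> = {}"
  then have "A \<subseteq> {\<one>}" using A_ext[OF _ one_A] by blast
  then have "Fix {} \<subseteq> stabilizer G \<phi> x"
    using action_one[OF x] by (auto simp: in_Fix_iff stabilizer_def)
  then show False using unsupported unfolding finitely_supported_def Fpow_def by blast
qed

lemma task_in: "\<Omega> \<noteq> {} \<Longrightarrow> task s \<in> UNIV \<times> \<Omega> \<times> \<Omega>"
  unfolding task_def by (intro from_nat_into) auto

lemma admissible_message:
  assumes "\<Omega> \<noteq> {}" and k: "\<And>i. k i \<in> A"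
  shows "admissible (message k)"
  unfolding admissible_def
proof (intro allI ballI)
  fix s R f g assume f: "f \<in> Fix (grow s R)" and g: "g \<in> A"
  obtain i u v where iuv: "task s = (i, u, v)" by (cases "task s")
  then have uv: "u \<in> \<Omega>" "v \<in> \<Omega>" using task_in[OF assms(1), of s] by auto
  then have "f u = u" using f iuv by (simp add: in_Fix_iff grow_def)
  then have "(f \<otimes> g \<otimes> k i) v = u \<longleftrightarrow> f ((g \<otimes> k i) v) = f u"
    using Fix_in_A[OF f] g k uv by (simp add: m_assoc mult_apply A_closed)
  also have "\<dots> \<longleftrightarrow> (g \<otimes> k i) v = u"
    using inv_apply[OF Fix_in_A[OF f]] uv A_closed[OF mult_A[OF g k]] by metis
  finally show "message k s (f \<otimes> g) \<longleftrightarrow> message k s g" by (simp add: message_def iuv)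
qed

lemma decode_message:
  assumes x: "x \<in> space N" and unsupported: "\<not> finitely_supported x" and k: "\<And>i. k i \<in> A"
  shows "\<exists>g\<in>A. \<forall>i. decode i (\<phi> g x) = g \<otimes> k i"
proof -
  have nonempty: "\<Omega> \<noteq> {}" by (rule not_finitely_supported_imp_nonempty[OF x unsupported])
  have "snd (snd (task s)) \<in> \<Omega>" for s using task_in[OF nonempty, of s] by auto
  moreover have "admissible (message k)" by (rule admissible_message[OF nonempty k])
  ultimately obtain g where g: "g \<in> A" "\<And>s. code_bit s (\<phi> g x) \<longleftrightarrow> message k s g"
    using coding[OF x unsupported] by blast
  have "decoded i (\<phi> g x) u v \<longleftrightarrow> (g \<otimes> k i) v = u" if "u \<in> \<Omega>" "v \<in> \<Omega>" for i u v
    using task_surj[OF that, of i] g(2) by (auto simp: decoded_def message_def)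
  then have "is_graph_of (decoded i (\<phi> g x)) (g \<otimes> k i)" for i
    using g(1) k by (simp add: is_graph_of_def)
  then show ?thesis using g(1) element_of_eq unfolding decode_def by blast
qed

lemma common_neighbour:
  assumes x: "x \<in> space N" and unsupported: "\<not> finitely_supported x" and h: "h \<in> A"
  shows "\<exists>y\<in>space N. \<phi> (decode True y) x = y \<and> \<phi> (decode False y) (\<phi> h x) = y"
proof -
  define k where "k i = (if i then \<one> else inv h)" for i
  have "k i \<in> A" for i using h by (simp add: k_def)
  then obtain g where "g \<in> A" "\<And>i. decode i (\<phi> g x) = g \<otimes> k i"
    using decode_message[OF x unsupported, of k] by blast
  then have g: "g \<in> A" "decode True (\<phi> g x) = g" "decode False (\<phi> g x) = g \<otimes> inv h"
    by (simp_all add: k_def)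
  have "\<phi> (g \<otimes> inv h) (\<phi> h x) = \<phi> g x"
    using g(1) h x by (simp add: action_mult_A action_closed_A action_inv)
  then show ?thesis using g action_closed_A[OF g(1) x] by (intro bexI[of _ "\<phi> g x"]) simp_all
qed

lemma finitely_supported_orbit:
  assumes x: "x \<in> space N" "finitely_supported x" and h: "h \<in> A"
    and D: "D \<subseteq> A" "\<forall>h\<in>A. \<forall>R\<in>Fpow \<Omega>. D \<inter> nbhd R h \<noteq> {}"
  shows "\<exists>g\<in>D. \<phi> g x = \<phi> h x"
proof -
  obtain R where R: "R \<in> Fpow \<Omega>" "Fix R \<subseteq> stabilizer G \<phi> x"
    using x(2) unfolding finitely_supported_def by blast
  then obtain g where g: "g \<in> D" "g \<in> nbhd R h" using D(2) h by blast
  then have gA: "g \<in> A" using D(1) by blast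
  have "(inv h \<otimes> g) r = r" if "r \<in> R" for r
  proof -
    have "r \<in> \<Omega>" using that R(1) Fpow_subset by blast
    moreover have "g r = h r" using g(2) that by (simp add: nbhd_def)
    ultimately show ?thesis using gA h by (simp add: mult_apply inv_apply)
  qed
  then have "inv h \<otimes> g \<in> Fix R" using gA h by (simp add: in_Fix_iff)
  then have "\<phi> (inv h \<otimes> g) x = x" using R(2) by (auto simp: stabilizer_def)
  then have "\<phi> h x = \<phi> (h \<otimes> (inv h \<otimes> g)) x" using gA h x(1) by (simp add: action_mult_A)
  also have "h \<otimes> (inv h \<otimes> g) = g" using gA h by (simp flip: m_assoc)
  finally show ?thesis using g(1) by metis
qed

lemma pred_varies: "Measurable.pred N (varies R n)"
proof -
  obtain s c where sc: "atom n = (s, c)" by fastforce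
  have s: "s \<in> S" and c: "c \<in> lists \<Omega>" using atom_in[of n] sc by simp_all
  have holds_iff: "holds n (\<phi> f y) \<longleftrightarrow> sat s (map (inv f) c) y" if "f \<in> A" "y \<in> space N" for f y
    using sat_action[OF s c, of "inv f" "\<phi> f y"] that
    by (simp add: holds_def sc action_closed_A action_inv)
  define C where "C = (\<lambda>f. map (inv f) c) ` Fix R"
  have C: "C \<subseteq> lists \<Omega>" using A_map_closed[OF inv_A[OF Fix_in_A] c] by (auto simp: C_def)
  then have "countable C" using countable_\<Omega> countable_lists countable_subset by blast
  then have "Measurable.pred N (\<lambda>y. (\<exists>d\<in>C. sat s d y) \<and> (\<exists>d\<in>C. \<not> sat s d y))"
    using C s by (intro pred_intros_logic pred_countable_Bex pred_sat) auto
  moreover have "varies R n y \<longleftrightarrow> (\<exists>d\<in>C. sat s d y) \<and> (\<exists>d\<in>C. \<not> sat s d y)" if "y \<in> space N" for y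
    using that holds_iff Fix_in_A by (simp add: varies_def C_def)
  ultimately show ?thesis by (subst measurable_cong)
qed

lemma measurable_site: "site R \<in> N \<rightarrow>\<^sub>M count_space UNIV"
  unfolding site_def[abs_def] by (intro measurable_Least pred_varies)

lemma measurable_stage: "stage s \<in> N \<rightarrow>\<^sub>M count_space (Fpow \<Omega>)"
proof (induction s)
  case 0
  show ?case by (simp add: Fpow_def)
next
  case (Suc s)
  have "(\<lambda>y. grow s R \<union> params (site (grow s R) y)) \<in> N \<rightarrow>\<^sub>M count_space (Fpow \<Omega>)"
    if R: "R \<in> Fpow \<Omega>" for R
  proof -
    have "(\<lambda>n. grow s R \<union> params n) \<in> count_space UNIV \<rightarrow>\<^sub>M count_space (Fpow \<Omega>)"
      using grow_Fpow[OF R] params_Fpow by (auto simp: Fpow_def)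
    from measurable_compose[OF measurable_site this] show ?thesis .
  qed
  from measurable_compose_countable'[OF this Suc countable_Fpow_\<Omega>]
  show ?case by simp
qed

lemma pred_code_bit: "Measurable.pred N (code_bit s)"
proof -
  have "Measurable.pred N (\<lambda>y. holds (site (grow s R) y) y)" for R
    by (rule measurable_compose_countable'[where I = UNIV and f = "\<lambda>n. holds n"])
      (use measurable_site pred_holds in auto)
  from measurable_compose_countable'[OF this measurable_stage countable_Fpow_\<Omega>]
  show ?thesis by (simp add: code_bit_def[abs_def])
qed

lemma measurable_decode: "decode i \<in> N \<rightarrow>\<^sub>M borel_of T"
proof -
  have "Measurable.pred N (\<lambda>y. decoded i y u v)" for u v
    unfolding decoded_def by (intro pred_intros_countable pred_intros_logic pred_code_bit) simp_all
  then show ?thesis unfolding decode_def[abs_def] by (intro measurable_element_of)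
qed

end

section \<open>Oligomorphic groups are graphic\<close>

context closed_perm_group
begin

text \<open>
  For fixed \<open>U\<close> and \<open>a\<close>, the Vaught transforms of \<open>U\<close> over the cylinders of \<open>c\<close> and \<open>a\<close> form a
  relation on tuples \<open>c\<close>.
\<close>

lemma vaught_equivariant_coding:
  assumes oligomorphic and "polish_group_action G T X \<phi>" and \<C>: "countable_base X \<C>"
  shows "equivariant_coding \<Omega> A (borel_of X) \<phi> (insert {} \<C> \<times> lists \<Omega>)
    (\<lambda>(U, a) c. polish_group_action.vaught T \<phi> (cylinder c a) U)"
proof -
  interpret action: polish_group_action G T X \<phi> by fact
  have \<C>': "countable_base X (insert {} \<C>)" by (rule countable_base_insert_empty[OF \<C>])
  have group_action: "group_action G (space (borel_of X)) \<phi>"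
    using action.group_action_axioms by simp
  show ?thesis
  proof (intro equivariant_coding.intro equivariant_coding_axioms.intro closed_perm_group_axioms
      group_action[unfolded G_def] assms(1))
    show "countable (insert {} \<C> \<times> lists \<Omega>)"
      using countable_base_countable[OF \<C>] countable_\<Omega> by (intro countable_SIGMA) auto
    show "insert {} \<C> \<times> lists \<Omega> \<noteq> {}" by auto
  next
    fix s c g y
    assume "s \<in> insert {} \<C> \<times> lists \<Omega>" "c \<in> lists \<Omega>" "g \<in> A" "y \<in> space (borel_of X)"
    then show "(case s of (U, a) \<Rightarrow> \<lambda>c. action.vaught (cylinder c a) U) (map g c) (\<phi> g y) \<longleftrightarrow>
        (case s of (U, a) \<Rightarrow> \<lambda>c. action.vaught (cylinder c a) U) c y"
      using action.vaught_translate[of "cylinder (map g c) (snd s)" g y "fst s"] cylinder_r_coset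
      by (cases s) (simp add: cylinder_def)
  next
    fix y y' assume y: "y \<in> space (borel_of X)" "y' \<in> space (borel_of X)"
      and eq: "\<And>s c. s \<in> insert {} \<C> \<times> lists \<Omega> \<Longrightarrow> c \<in> lists \<Omega> \<Longrightarrow>
        (case s of (U, a) \<Rightarrow> \<lambda>c. action.vaught (cylinder c a) U) c y \<longleftrightarrow>
        (case s of (U, a) \<Rightarrow> \<lambda>c. action.vaught (cylinder c a) U) c y'"
    show "y = y'"
    proof (rule action.vaught_separates[OF countable_base_cylinders \<C>])
      show "action.vaught V U y \<longleftrightarrow> action.vaught V U y'"
        if "V \<in> (\<lambda>(c, a). cylinder c a) ` (lists \<Omega> \<times> lists \<Omega>)" "U \<in> \<C>" for V U
        using that eq[of "(U, _)"] by auto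
    qed (use y in auto)
  next
    fix s c assume "s \<in> insert {} \<C> \<times> lists \<Omega>" "c \<in> lists \<Omega>"
    then show "Measurable.pred (borel_of X)
        ((case s of (U, a) \<Rightarrow> \<lambda>c. action.vaught (cylinder c a) U) c)"
      using countable_base_openin[OF \<C>', of "fst s"]
        action.vaught_borel_of[OF openin_cylinder, of c "fst s" "snd s"]
      by (cases s) (simp add: pred_def)
  qed
qed

lemma borel_graph_if_oligomorphic:
  assumes oligomorphic and "polish_group_action G T X \<phi>"
  shows "\<exists>E. borel_graph X E \<and> orbit_equivalence_relation G X \<phi> = connectedness_relation X E"
proof -
  interpret action: polish_group_action G T X \<phi> by fact
  obtain \<C> where \<C>: "countable_base X \<C>"
    by (rule polish_space_countable_base[OF action.polish_X])
  interpret code: equivariant_coding \<Omega> A G T "borel_of X" \<phi> "insert {} \<C> \<times> lists \<Omega>"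
    "\<lambda>(U, a) c. action.vaught (cylinder c a) U"
    by (rule vaught_equivariant_coding[OF assms \<C>]) (simp_all add: G_def T_def)
  obtain D where D: "countable D" "D \<subseteq> A" "\<forall>h\<in>A. \<forall>R\<in>Fpow \<Omega>. D \<inter> nbhd R h \<noteq> {}"
    by (rule countable_dense_subset[OF order_refl]) blast
  define E where "E = (\<lambda>g _. g) ` D \<union> range code.decode"
  let ?H = "\<Union>e\<in>E. action.mover_graph e"
  have edge: "(x, y) \<in> ?H" if "e \<in> E" "x \<in> topspace X" "y \<in> topspace X" "\<phi> (e y) x = y" for e x y
    using that by (auto simp: action.mover_graph_def)
  show ?thesis
  proof (rule action.borel_graph_of_mover_graphs)
    show "countable E" using D(1) by (simp add: E_def)
    show "e \<in> borel_of X \<rightarrow>\<^sub>M borel_of T" if "e \<in> E" for e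
      using that D(2) code.measurable_decode by (auto simp: E_def)
    fix x h assume x: "x \<in> topspace X" and "h \<in> carrier G"
    then have h: "h \<in> A" and hx: "\<phi> h x \<in> topspace X" using action.action_closed by auto
    show "(x, \<phi> h x) \<in> (?H \<union> ?H\<inverse>)\<^sup>*"
    proof (cases "code.finitely_supported x")
      case True
      then obtain g where "g \<in> D" "\<phi> g x = \<phi> h x"
        using code.finitely_supported_orbit[OF _ _ h D(2,3)] x by auto
      then have "(x, \<phi> h x) \<in> ?H" by (intro edge[of "\<lambda>_. g"] x hx) (auto simp: E_def)
      then show ?thesis by blast
    next
      case False
      then obtain y where y: "y \<in> topspace X" "\<phi> (code.decode True y) x = y"
          "\<phi> (code.decode False y) (\<phi> h x) = y"
        using code.common_neighbour[OF _ _ h] x by auto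
      have "(x, y) \<in> ?H" by (rule edge[of "code.decode True"]) (use x y in \<open>auto simp: E_def\<close>)
      moreover have "(\<phi> h x, y) \<in> ?H"
        by (rule edge[of "code.decode False"]) (use hx y in \<open>auto simp: E_def\<close>)
      ultimately show ?thesis by (blast intro: rtrancl_trans)
    qed
  qed
qed

theorem graphic_if_oligomorphic:
  assumes oligomorphic
  shows "graphic TYPE('x) G T"
  unfolding graphic_def
proof (intro conjI allI impI polish_group_T)
  fix X :: "'x topology" and \<phi>
  assume "polish_space X \<and> borel_action G T X \<phi>"
  then have "polish_group_action G T X \<phi>"
    using polish_group_T by (simp add: polish_group_action_def)
  then show "\<exists>E. borel_graph X E \<and> orbit_equivalence_relation G X \<phi> = connectedness_relation X E"
    by (rule borel_graph_if_oligomorphic[OF assms])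
qed

end

section \<open>Automorphism groups of ultrahomogeneous structures\<close>

lemma structure_iso_interp:
  assumes "f \<in> structure_iso L M N"
    and "r \<in> symbols L" "xs \<in> lists (universe M)" "length xs = arity L r"
  shows "map f xs \<in> interp N r \<longleftrightarrow> xs \<in> interp M r"
  using assms by (simp add: structure_iso_def)

lemma structure_iso_bij: "f \<in> structure_iso L M N \<Longrightarrow> bij_betw f (universe M) (universe N)"
  by (simp add: structure_iso_def)

lemma structure_isoI:
  assumes "bij_betw f (universe M) (universe N)"
    and "\<And>r xs. r \<in> symbols L \<Longrightarrow> xs \<in> lists (universe M) \<Longrightarrow> length xs = arity L r \<Longrightarrow>
      map f xs \<in> interp N r \<longleftrightarrow> xs \<in> interp M r"
  shows "f \<in> structure_iso L M N"
  using assms by (auto simp: structure_iso_def)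

lemma structure_iso_restrict_id: "(\<lambda>x\<in>universe M. x) \<in> structure_iso L M M"
proof (rule structure_isoI)
  show "bij_betw (\<lambda>x\<in>universe M. x) (universe M) (universe M)"
    using id_Bij[of "universe M"] by (simp add: Bij_def)
  show "map (\<lambda>x\<in>universe M. x) xs \<in> interp M r \<longleftrightarrow> xs \<in> interp M r"
    if "xs \<in> lists (universe M)" for r xs
  proof -
    have "map (\<lambda>x\<in>universe M. x) xs = xs" using that by (intro map_idI) auto
    then show ?thesis by simp
  qed
qed

lemma structure_iso_inv_into:
  assumes f: "f \<in> structure_iso L M N"
  shows "(\<lambda>x\<in>universe N. inv_into (universe M) f x) \<in> structure_iso L N M"
proof (rule structure_isoI)
  let ?inv = "\<lambda>x\<in>universe N. inv_into (universe M) f x"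
  have bij: "bij_betw f (universe M) (universe N)" by (rule structure_iso_bij[OF f])
  show inv_bij: "bij_betw ?inv (universe N) (universe M)"
    using bij_betw_inv_into[OF bij] by simp
  fix r xs assume r: "r \<in> symbols L" "xs \<in> lists (universe N)" "length xs = arity L r"
  have "map ?inv xs \<in> lists (universe M)"
    using r(2) bij_betwE[OF inv_bij] by auto
  moreover have "map f (map ?inv xs) = xs"
    using r(2) bij_betw_inv_into_right[OF bij] by (auto intro!: map_idI)
  ultimately show "map ?inv xs \<in> interp M r \<longleftrightarrow> xs \<in> interp N r"
    using structure_iso_interp[OF f r(1), of "map ?inv xs"] r(3) by simp
qed

lemma structure_iso_compose:
  assumes f: "f \<in> structure_iso L N P" and g: "g \<in> structure_iso L M N"
  shows "compose (universe M) f g \<in> structure_iso L M P"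
proof (rule structure_isoI)
  show "bij_betw (compose (universe M) f g) (universe M) (universe P)"
    by (rule bij_betw_compose[OF structure_iso_bij[OF g] structure_iso_bij[OF f]])
  fix r xs assume r: "r \<in> symbols L" "xs \<in> lists (universe M)" "length xs = arity L r"
  have "map g xs \<in> lists (universe N)"
    using r(2) bij_betwE[OF structure_iso_bij[OF g]] by auto
  moreover have "map (compose (universe M) f g) xs = map f (map g xs)"
    using r(2) by (auto simp: compose_eq)
  ultimately show "map (compose (universe M) f g) xs \<in> interp P r \<longleftrightarrow> xs \<in> interp M r"
    using structure_iso_interp[OF f r(1), of "map g xs"] structure_iso_interp[OF g r] r(3)
    by (simp del: map_map)
qed

lemma subgroup_automorphisms: "subgroup (automorphisms L M) (BijGroup (universe M))"
proof (rule group.subgroupI[OF group_BijGroup])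
  let ?\<Omega> = "universe M"
  have aut: "f \<in> Bij ?\<Omega>" "f \<in> structure_iso L M M" if "f \<in> automorphisms L M" for f
    using that by (simp_all add: automorphisms_def)
  show "automorphisms L M \<subseteq> carrier (BijGroup ?\<Omega>)"
    using aut(1) by (auto simp: BijGroup_def)
  show "automorphisms L M \<noteq> {}"
    using structure_iso_restrict_id id_Bij unfolding automorphisms_def by blast
  show "inv\<^bsub>BijGroup ?\<Omega>\<^esub> f \<in> automorphisms L M" if "f \<in> automorphisms L M" for f
    using structure_iso_inv_into[OF aut(2)[OF that]] restrict_inv_into_Bij[OF aut(1)[OF that]]
    by (simp add: automorphisms_def inv_BijGroup[OF aut(1)[OF that]])
  show "f \<otimes>\<^bsub>BijGroup ?\<Omega>\<^esub> g \<in> automorphisms L M"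
    if "f \<in> automorphisms L M" "g \<in> automorphisms L M" for f g
    using structure_iso_compose[OF aut(2)[OF that(1)] aut(2)[OF that(2)]]
      compose_Bij[OF aut(1)[OF that(1)] aut(1)[OF that(2)]] that[THEN aut(1)]
    by (simp add: automorphisms_def BijGroup_def)
qed

lemma automorphisms_closed:
  assumes f: "f \<in> Bij (universe M)"
    and approx: "\<And>R. R \<in> Fpow (universe M) \<Longrightarrow> \<exists>g\<in>automorphisms L M. \<forall>v\<in>R. g v = f v"
  shows "f \<in> automorphisms L M"
proof -
  have "f \<in> structure_iso L M M"
  proof (rule structure_isoI)
    show "bij_betw f (universe M) (universe M)" using f by (simp add: Bij_def)
    fix r xs assume r: "r \<in> symbols L" "xs \<in> lists (universe M)" "length xs = arity L r"
    then have "set xs \<in> Fpow (universe M)" by (auto simp: Fpow_def)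
    then obtain g where g: "g \<in> automorphisms L M" "\<forall>v\<in>set xs. g v = f v" using approx by blast
    have "map f xs = map g xs" using g(2) by simp
    moreover have "g \<in> structure_iso L M M" using g(1) by (simp add: automorphisms_def)
    then have "map g xs \<in> interp M r \<longleftrightarrow> xs \<in> interp M r" by (rule structure_iso_interp[OF _ r])
    ultimately show "map f xs \<in> interp M r \<longleftrightarrow> xs \<in> interp M r" by (simp only:)
  qed
  then show ?thesis using f by (simp add: automorphisms_def)
qed

lemma closed_perm_group_automorphisms:
  assumes "countable (universe M)"
  shows "closed_perm_group (universe M) (automorphisms L M)"
proof (rule closed_perm_group.intro[OF subgroup_automorphisms assms])
  fix f assume "f \<in> Bij (universe M)"
    and "\<And>R. R \<in> Fpow (universe M) \<Longrightarrow> \<exists>g\<in>automorphisms L M. \<forall>v\<in>R. g v = f v"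
  then show "f \<in> automorphisms L M" by (rule automorphisms_closed)
qed

text \<open>In a list of terms, \<open>None\<close> is the variable, of which \<open>v\<close> is the value.\<close>

definition qf_type ::
  "'r rel_language \<Rightarrow> ('r, 'a) rel_structure \<Rightarrow> 'a set \<Rightarrow> 'a \<Rightarrow> ('r \<times> 'a option list) set" where
  "qf_type L M R v = {(r, ts). r \<in> symbols L \<and> set ts \<subseteq> insert None (Some ` R) \<and>
     length ts = arity L r \<and> map (case_option v id) ts \<in> interp M r}"

lemma finite_range_qf_type:
  assumes "finite (symbols L)" "finite R"
  shows "finite (range (qf_type L M R))"
proof (rule finite_subset)
  let ?K = "SIGMA r:symbols L. {ts. set ts \<subseteq> insert None (Some ` R) \<and> length ts = arity L r}"
  show "range (qf_type L M R) \<subseteq> Pow ?K" by (auto simp: qf_type_def)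
  show "finite (Pow ?K)"
    using assms by (simp add: finite_lists_length_eq)
qed

lemma structure_iso_same_qf_type:
  assumes v: "v \<notin> R" and w: "w \<notin> R" and eq: "qf_type L M R v = qf_type L M R w"
  shows "id(v := w) \<in> structure_iso L (substructure M (insert v R)) (substructure M (insert w R))"
proof (rule structure_isoI)
  show "bij_betw (id(v := w)) (universe (substructure M (insert v R)))
      (universe (substructure M (insert w R)))"
    using v w by (auto simp: bij_betw_def inj_on_def substructure_def image_iff)
  fix r xs assume r: "r \<in> symbols L" "xs \<in> lists (universe (substructure M (insert v R)))"
    "length xs = arity L r"
  define ts where "ts = map (\<lambda>z. if z = v then None else Some z) xs"
  have xs: "set xs \<subseteq> insert v R" using r(2) by (auto simp: substructure_def)
  have "map (case_option v id) ts = xs" by (auto simp: ts_def intro!: map_idI)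
  moreover have "map (case_option w id) ts = map (id(v := w)) xs" by (auto simp: ts_def)
  moreover have "map (case_option v id) ts \<in> interp M r \<longleftrightarrow> map (case_option w id) ts \<in> interp M r"
  proof -
    have "set ts \<subseteq> insert None (Some ` R)" "length ts = arity L r"
      using xs r(3) by (auto simp: ts_def)
    moreover have "(r, ts) \<in> qf_type L M R v \<longleftrightarrow> (r, ts) \<in> qf_type L M R w" using eq by simp
    ultimately show ?thesis using r(1) by (simp add: qf_type_def)
  qed
  moreover have "xs \<in> lists (insert v R)" "map (id(v := w)) xs \<in> lists (insert w R)"
    using xs by auto
  ultimately show "map (id(v := w)) xs \<in> interp (substructure M (insert w R)) r \<longleftrightarrow>
      xs \<in> interp (substructure M (insert v R)) r"
    by (simp add: substructure_def)
qed

lemma ultrahomogeneousD: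
  assumes "ultrahomogeneous L M" "A \<in> Fpow (universe M)" "B \<in> Fpow (universe M)"
    and "f \<in> structure_iso L (substructure M A) (substructure M B)"
  shows "\<exists>g\<in>automorphisms L M. \<forall>a\<in>A. g a = f a"
  using assms unfolding ultrahomogeneous_def Fpow_def by blast

lemma ultrahomogeneous_move:
  assumes ultra: "ultrahomogeneous L M" and R: "R \<in> Fpow (universe M)"
    and v: "v \<in> universe M - R" and w: "w \<in> universe M - R"
    and eq: "qf_type L M R v = qf_type L M R w"
  shows "\<exists>f\<in>automorphisms L M. (\<forall>r\<in>R. f r = r) \<and> f v = w"
proof -
  have "id(v := w) \<in> structure_iso L (substructure M (insert v R)) (substructure M (insert w R))"
    using v w eq by (intro structure_iso_same_qf_type) auto
  moreover have "insert v R \<in> Fpow (universe M)" "insert w R \<in> Fpow (universe M)"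
    using R v w by (auto simp: Fpow_def)
  ultimately obtain f where f: "f \<in> automorphisms L M" "\<forall>a\<in>insert v R. f a = (id(v := w)) a"
    using ultrahomogeneousD[OF ultra] by blast
  then have "\<forall>r\<in>R. f r = r" "f v = w" using v by auto
  then show ?thesis using f(1) by blast
qed

lemma ultrahomogeneous_finitely_many_orbits:
  assumes L: "finite (symbols L)" and ultra: "ultrahomogeneous L M" and R: "R \<in> Fpow (universe M)"
  shows "\<exists>S\<in>Fpow (universe M). \<forall>v\<in>universe M.
    \<exists>f\<in>automorphisms L M. (\<forall>r\<in>R. f r = r) \<and> f v \<in> S"
proof -
  have R': "finite R" "R \<subseteq> universe M" using R by (auto simp: Fpow_def)
  have "finite (qf_type L M R ` (universe M - R))"
    by (rule finite_subset[OF _ finite_range_qf_type[OF L R'(1)]]) auto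
  from finite_subset_image[OF this order_refl] obtain S where S: "S \<subseteq> universe M - R" "finite S"
      "qf_type L M R ` (universe M - R) = qf_type L M R ` S"
    by blast
  have "\<exists>f\<in>automorphisms L M. (\<forall>r\<in>R. f r = r) \<and> f v \<in> R \<union> S" if v: "v \<in> universe M" for v
  proof (cases "v \<in> R")
    case True
    have "(\<lambda>x\<in>universe M. x) \<in> automorphisms L M"
      using structure_iso_restrict_id id_Bij by (auto simp: automorphisms_def)
    then show ?thesis using True R' by (intro bexI[of _ "\<lambda>x\<in>universe M. x"]) auto
  next
    case False
    then have "qf_type L M R v \<in> qf_type L M R ` S" using v S(3) by blast
    then obtain w where "w \<in> S" "qf_type L M R v = qf_type L M R w" by auto
    then show ?thesis using ultrahomogeneous_move[OF ultra R, of v w] False v S(1) by blast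
  qed
  moreover have "R \<union> S \<in> Fpow (universe M)" using R' S(1,2) by (auto simp: Fpow_def)
  ultimately show ?thesis by blast
qed

lemma oligomorphic_automorphisms:
  assumes "finite (symbols L)" "ultrahomogeneous L M" "countable (universe M)"
  shows "closed_perm_group.oligomorphic (universe M) (automorphisms L M)"
proof -
  interpret closed_perm_group "universe M" "automorphisms L M" "Aut_group L M" "Aut_topology L M"
    by (rule closed_perm_group_automorphisms[OF assms(3)])
      (simp_all add: Aut_group_def Aut_topology_def)
  show ?thesis
    unfolding oligomorphic_def
    using ultrahomogeneous_finitely_many_orbits[OF assms(1,2)] by (auto simp: Bex_def in_Fix_iff)
qed

section \<open>Invariance under isomorphism of topological groups\<close>

lemma topological_group_isomorphic_inverse:
  assumes \<Gamma>: "topological_group \<Gamma> T" and \<Delta>: "topological_group \<Delta> S"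
    and iso: "topological_group_isomorphic \<Gamma> T \<Delta> S"
  obtains \<xi> where "\<xi> \<in> hom \<Delta> \<Gamma>" "\<xi> ` carrier \<Delta> = carrier \<Gamma>" "continuous_map S T \<xi>"
proof -
  obtain \<psi> where \<psi>: "\<psi> \<in> iso \<Gamma> \<Delta>" "homeomorphic_map T S \<psi>"
    using iso unfolding topological_group_isomorphic_def by blast
  then obtain \<xi> where \<xi>: "homeomorphic_maps T S \<psi> \<xi>" using homeomorphic_map_maps by blast
  have groups: "group \<Gamma>" "topspace T = carrier \<Gamma>" "topspace S = carrier \<Delta>"
    using \<Gamma> \<Delta> by (auto simp: topological_group_def)
  have \<xi>_inverse: "\<xi> (\<psi> g) = g" if "g \<in> carrier \<Gamma>" for g
    using \<xi> that groups(2) by (simp add: homeomorphic_maps_def)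
  have bij: "bij_betw \<psi> (carrier \<Gamma>) (carrier \<Delta>)" using \<psi>(1) by (simp add: iso_def)
  have "\<xi> \<in> hom \<Delta> \<Gamma>"
  proof (rule homI)
    fix x y assume "x \<in> carrier \<Delta>" "y \<in> carrier \<Delta>"
    then have "x \<in> \<psi> ` carrier \<Gamma>" "y \<in> \<psi> ` carrier \<Gamma>"
      using bij by (simp_all add: bij_betw_def)
    then obtain g h where gh: "g \<in> carrier \<Gamma>" "h \<in> carrier \<Gamma>" "x = \<psi> g" "y = \<psi> h" by blast
    then show "\<xi> x \<in> carrier \<Gamma>" by (simp add: \<xi>_inverse)
    have "\<psi> (g \<otimes>\<^bsub>\<Gamma>\<^esub> h) = x \<otimes>\<^bsub>\<Delta>\<^esub> y" using \<psi>(1) gh by (simp add: iso_def hom_mult)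
    then show "\<xi> (x \<otimes>\<^bsub>\<Delta>\<^esub> y) = \<xi> x \<otimes>\<^bsub>\<Gamma>\<^esub> \<xi> y"
      using gh \<xi>_inverse groups(1) by (metis group.is_monoid monoid.m_closed)
  qed
  moreover have "\<xi> ` carrier \<Delta> = carrier \<Gamma>"
    using bij \<xi>_inverse by (force simp: bij_betw_def)
  moreover have "continuous_map S T \<xi>" using \<xi> by (simp add: homeomorphic_maps_def)
  ultimately show thesis by (rule that)
qed

lemma borel_action_hom:
  assumes action: "borel_action \<Gamma> T X \<phi>" and \<Delta>: "group \<Delta>"
    and \<xi>: "\<xi> \<in> hom \<Delta> \<Gamma>" "continuous_map S T \<xi>"
  shows "borel_action \<Delta> S X (\<phi> \<circ> \<xi>)"
proof -
  have hom: "group_hom \<Gamma> (BijGroup (topspace X)) \<phi>"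
    and measurable: "(\<lambda>(g, x). \<phi> g x) \<in> borel_of (prod_topology T X) \<rightarrow>\<^sub>M borel_of X"
    using action by (auto simp: borel_action_def group_action_def)
  have "\<phi> \<circ> \<xi> \<in> hom \<Delta> (BijGroup (topspace X))"
    using \<xi>(1) group_hom.homh[OF hom] by (rule hom_compose)
  then have "group_action \<Delta> (topspace X) (\<phi> \<circ> \<xi>)"
    using \<Delta> group_BijGroup by (simp add: group_action_def group_hom_def group_hom_axioms_def)
  moreover have "continuous_map (prod_topology S X) (prod_topology T X) (\<lambda>p. (\<xi> (fst p), snd p))"
    using continuous_map_compose[OF continuous_map_fst \<xi>(2)]
    by (simp add: continuous_map_pairwise o_def continuous_map_snd)
  from measurable_compose[OF continuous_map_measurable[OF this] measurable]
  have "(\<lambda>(g, x). (\<phi> \<circ> \<xi>) g x) \<in> borel_of (prod_topology S X) \<rightarrow>\<^sub>M borel_of X"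
    by (simp add: case_prod_beta)
  ultimately show ?thesis by (simp add: borel_action_def)
qed

lemma graphic_isomorphic:
  assumes \<Delta>: "graphic TYPE('x) \<Delta> S" and \<Gamma>: "topological_group \<Gamma> T"
    and iso: "topological_group_isomorphic \<Gamma> T \<Delta> S"
  shows "graphic TYPE('x) \<Gamma> T"
proof -
  have polish_\<Delta>: "topological_group \<Delta> S" "polish_space S"
    using \<Delta> by (simp_all add: graphic_def polish_group_def)
  obtain \<xi> where \<xi>: "\<xi> \<in> hom \<Delta> \<Gamma>" "\<xi> ` carrier \<Delta> = carrier \<Gamma>" "continuous_map S T \<xi>"
    by (rule topological_group_isomorphic_inverse[OF \<Gamma> polish_\<Delta>(1) iso])
  have "T homeomorphic_space S"
    using iso homeomorphic_map_imp_homeomorphic_space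
    unfolding topological_group_isomorphic_def by blast
  then have "polish_space T"
    using polish_\<Delta>(2) homeomorphic_completely_metrizable_space homeomorphic_separable_space
    unfolding polish_space_def by blast
  moreover have "\<exists>E. borel_graph X E \<and>
      orbit_equivalence_relation \<Gamma> X \<phi> = connectedness_relation X E"
    if X: "polish_space X" and action: "borel_action \<Gamma> T X \<phi>" for X :: "'x topology" and \<phi>
  proof -
    have "borel_action \<Delta> S X (\<phi> \<circ> \<xi>)"
      using polish_\<Delta>(1)
      by (intro borel_action_hom[OF action _ \<xi>(1,3)]) (simp add: topological_group_def)
    then obtain E where E: "borel_graph X E"
        "orbit_equivalence_relation \<Delta> X (\<phi> \<circ> \<xi>) = connectedness_relation X E"
      using \<Delta> X unfolding graphic_def by blast
    have "orbit \<Gamma> \<phi> x = orbit \<Delta> (\<phi> \<circ> \<xi>) x" for x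
      unfolding orbit_def \<xi>(2)[symmetric] by auto
    then show ?thesis using E by (auto simp: orbit_equivalence_relation_def)
  qed
  ultimately show ?thesis using \<Gamma> by (simp add: graphic_def polish_group_def)
qed

theorem theorem4p14:
  fixes L :: "'r rel_language"
    and M :: "('r, 'a) rel_structure"
    and \<Gamma> :: "('g, 'm) monoid_scheme"
    and T :: "'g topology"
  assumes "finite (symbols L)"
    and "is_structure L M"
    and "countable (universe M)"
    and "ultrahomogeneous L M"
    and "topological_group \<Gamma> T"
    and "topological_group_isomorphic \<Gamma> T (Aut_group L M) (Aut_topology L M)"
  shows "graphic TYPE('x) \<Gamma> T"
proof (rule graphic_isomorphic[OF _ assms(5,6)])
  interpret closed_perm_group "universe M" "automorphisms L M" "Aut_group L M" "Aut_topology L M"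
    by (rule closed_perm_group_automorphisms[OF assms(3)])
      (simp_all add: Aut_group_def Aut_topology_def)
  show "graphic TYPE('x) (Aut_group L M) (Aut_topology L M)"
    by (intro graphic_if_oligomorphic oligomorphic_automorphisms assms(1,3,4))
qed

end
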